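(* Let $q\ge 3$ and let $i,j,n$ be integers with $0\le i\le j$ and $n\ge i+j$. Let $f:\Sigma_q^n\to\mathbb{R}$ with $f\in U_{[i,j]}(n,q)$ and $f\not\equiv 0$. Then $|f|\ge 2^{i}(q-1)^{i}q^{n-i-j}$. Moreover, $|f|=2^{i}(q-1)^{i}q^{n-i-j}$ holds if and only if $f_\sigma\in F_1(n,q,i,j)$ for some permutation $\sigma\in S_n$.
   Context: $\Sigma_q=\{0,1,\dots,q-1\}$. The Hamming graph $H(n,q)$ has vertex set $\Sigma_q^n$, two vertices being adjacent iff they differ in exactly one coordinate. A function $f:\Sigma_q^n\to\mathbb{R}$ is a $\lambda$-eigenfunction of $H(n,q)$ if $\lambda f(x)=\sum_{y\text{ adjacent to }x}f(y)$ for all $x$. For an integer $t$, $\lambda_t(n,q)=n(q-1)-qt$ and $U_t(n,q)$ is the space of $\lambda_t(n,q)$-eigenfunctions of $H(n,q)$ (the eigenvalues of $H(n,q)$ are $\lambda_t(n,q)$, $0\le t\le n$). For $i\le j$, $U_{[i,j]}(n,q)=U_i(n,q)\oplus\cdots\oplus U_j(n,q)$. $|f|$ denotes the number of $x$ with $f(x)\ne0$. For $\sigma\in S_n$, $f_\sigma(x_1,\dots,x_n)=f(x_{\sigma(1)},\dots,x_{\sigma(n)})$. Elementary functions: for $k,m\in\Sigma_q$, $a_1(k,m):\Sigma_q^2\to\mathbb{R}$ is $1$ if $x=k,y\ne m$; $-1$ if $y=m,x\ne k$; $0$ otherwise; $A_1$ is the set of all $a_1(k,m)$. $A_3$ consists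 of the constant function $1$ on $\Sigma_q$. For $m\in\Sigma_q$, $a_4(m):\Sigma_q\to\mathbb{R}$ is the indicator of $\{m\}$; $A_4$ is the set of all $a_4(m)$. If $f_1,\dots,f_s$ are functions on $\Sigma_q^{n_1},\dots,\Sigma_q^{n_s}$, their product $f_1\cdots f_s$ is the function on $\Sigma_q^{n_1+\dots+n_s}$ given by $(x^{(1)},\dots,x^{(s)})\mapsto\prod_t f_t(x^{(t)})$ (consecutive blocks of coordinates, in the given order). For $n\ge i+j$, $F_1(n,q,i,j)$ is the set of functions $f:\Sigma_q^n\to\mathbb{R}$ of the form $f=c\cdot\prod_{k=1}^{i}g_k\cdot\prod_{k=1}^{n-i-j}h_k\cdot\prod_{k=1}^{j-i}v_k$ with $c$ a real constant, $g_k\in A_1$, $h_k\in A_3$, $v_k\in A_4$. *)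

theory Defs
  imports Complex_Main "HOL-Combinatorics.Permutations"
begin

text \<open>A function on \<open>\<Sigma>\<^sub>q\<^sup>n\<close> is represented by a function on lists of natural numbers of which only
  the values on \<open>words n q\<close> matter; all notions below look at these values only. Coordinates are
  numbered from 0.\<close>

definition words :: "nat \<Rightarrow> nat \<Rightarrow> nat list set" where
  "words n q = {x. set x \<subseteq> {..<q} \<and> length x = n}"

definition hamming_adj :: "nat \<Rightarrow> nat list \<Rightarrow> nat list \<Rightarrow> bool" where
  "hamming_adj n x y \<longleftrightarrow> card {k. k < n \<and> x ! k \<noteq> y ! k} = 1"

definition eigenfunction :: "nat \<Rightarrow> nat \<Rightarrow> real \<Rightarrow> (nat list \<Rightarrow> real) \<Rightarrow> bool" where
  "eigenfunction n q l f \<longleftrightarrow>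
     (\<forall>x\<in>words n q. l * f x = (\<Sum>y | y \<in> words n q \<and> hamming_adj n x y. f y))"

definition eigval :: "nat \<Rightarrow> nat \<Rightarrow> nat \<Rightarrow> real" where
  "eigval t n q = real n * (real q - 1) - real q * real t"

definition U :: "nat \<Rightarrow> nat \<Rightarrow> nat \<Rightarrow> (nat list \<Rightarrow> real) set" where
  "U t n q = {f. eigenfunction n q (eigval t n q) f}"

text \<open>The sum of the eigenspaces \<open>U t n q\<close> for \<open>i \<le> t \<le> j\<close>; on \<open>words n q\<close> it is direct, since
  the eigenvalues are pairwise distinct for \<open>q > 0\<close>.\<close>

definition U_range :: "nat \<Rightarrow> nat \<Rightarrow> nat \<Rightarrow> nat \<Rightarrow> (nat list \<Rightarrow> real) set" where
  "U_range i j n q = {f. \<exists>g. (\<forall>t\<in>{i..j}. g t \<in> U t n q) \<and>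
                             (\<forall>x\<in>words n q. f x = (\<Sum>t=i..j. g t x))}"

definition supp_size :: "nat \<Rightarrow> nat \<Rightarrow> (nat list \<Rightarrow> real) \<Rightarrow> nat" where
  "supp_size n q f = card {x \<in> words n q. f x \<noteq> 0}"

text \<open>\<open>permute_list \<sigma> x\<close> is the list \<open>x ! \<sigma> 0, x ! \<sigma> 1, \<dots>\<close>.\<close>

definition permute_fun :: "(nat \<Rightarrow> nat) \<Rightarrow> (nat list \<Rightarrow> real) \<Rightarrow> nat list \<Rightarrow> real" where
  "permute_fun \<sigma> f x = f (permute_list \<sigma> x)"

definition a1 :: "nat \<Rightarrow> nat \<Rightarrow> nat list \<Rightarrow> real" where
  "a1 k m z = (if z ! 0 = k \<and> z ! 1 \<noteq> m then 1
               else if z ! 1 = m \<and> z ! 0 \<noteq> k then -1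
               else 0)"

definition A1 :: "nat \<Rightarrow> (nat list \<Rightarrow> real) set" where
  "A1 q = {a1 k m | k m. k < q \<and> m < q}"

definition A3 :: "(nat list \<Rightarrow> real) set" where
  "A3 = {\<lambda>z. 1}"

definition a4 :: "nat \<Rightarrow> nat list \<Rightarrow> real" where
  "a4 m z = (if z ! 0 = m then 1 else 0)"

definition A4 :: "nat \<Rightarrow> (nat list \<Rightarrow> real) set" where
  "A4 q = {a4 m | m. m < q}"

text \<open>Each factor is paired with the number of coordinates it consumes.\<close>

fun block_prod :: "(nat \<times> (nat list \<Rightarrow> real)) list \<Rightarrow> nat list \<Rightarrow> real" where
  "block_prod [] x = 1"
| "block_prod ((m, g) # gs) x = g (take m x) * block_prod gs (drop m x)"

text \<open>Meaningful for \<open>i \<le> j\<close> and \<open>i + j \<le> n\<close>, where the subtractions do not truncate.\<close>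

definition F1 :: "nat \<Rightarrow> nat \<Rightarrow> nat \<Rightarrow> nat \<Rightarrow> (nat list \<Rightarrow> real) set" where
  "F1 n q i j = {f. \<exists>c gs hs vs.
      length gs = i \<and> set gs \<subseteq> A1 q \<and>
      length hs = n - i - j \<and> set hs \<subseteq> A3 \<and>
      length vs = j - i \<and> set vs \<subseteq> A4 q \<and>
      (\<forall>x\<in>words n q.
         f x = c * block_prod (map (Pair 2) gs @ map (Pair 1) hs @ map (Pair 1) vs) x)}"

end

theory Submission
  imports Defs "HOL-Library.FuncSet"
begin

text \<open>
  Fix a coordinate and let \<open>f\<^sub>k\<close> be the restrictions of \<open>f\<close> to the \<open>q\<close> values of that coordinate.
  If \<open>f \<in> U\<^bsub>[i,j]\<^esub>\<close>, then on \<open>n - 1\<close> coordinates \<open>f\<^sub>k \<in> U\<^bsub>[i-1,j]\<^esub>\<close>,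
  \<open>f\<^sub>k - f\<^sub>m \<in> U\<^bsub>[i-1,j-1]\<^esub>\<close> and \<open>\<Sum>\<^sub>k f\<^sub>k \<in> U\<^bsub>[i,j]\<^esub>\<close>, where \<open>i - 1\<close> is read as \<open>0\<close> if \<open>i = 0\<close>.
  Let \<open>N(n,i,j)\<close> be the claimed minimum and choose a coordinate in which \<open>f\<close> is not constant. By
  induction two different slices together have support at least \<open>N(n-1,i-1,j-1)\<close>. If two slices
  differ from one of least support, the bound is strict. Otherwise all slices but one \<open>f\<^sub>k\<close> coincide:
  either they vanish and \<open>f\<^sub>k \<in> U\<^bsub>[i,j-1]\<^esub>\<close>, or the bound follows by adding up.

  For equality in the latter case, a slice \<open>h\<close> other than \<open>f\<^sub>k\<close> is extremal for \<open>(i-1,j)\<close> and so, by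
  induction, is supported on \<open>y = m\<close> for some coordinate \<open>y\<close>. Slicing \<open>f\<close> along \<open>y\<close> and counting
  shows that \<open>f\<close> lives on \<open>{x = k, y \<noteq> m} \<union> {x \<noteq> k, y = m}\<close>. The difference \<open>f\<^sub>k - h\<close> is extremal
  for \<open>(i-1,j-1)\<close> and all its slices along \<open>y\<close> have equal support, which forces it to be constant
  in \<open>y\<close>; so \<open>f = a\<^sub>1(k,m) u\<close> with \<open>u\<close> extremal for \<open>(i-1,j-1)\<close> on \<open>n - 2\<close> coordinates.
\<close>

subsection \<open>Functions on cubes and their slices\<close>

definition slice :: "'a \<Rightarrow> 'b \<Rightarrow> (('a \<Rightarrow> 'b) \<Rightarrow> 'c) \<Rightarrow> ('a \<Rightarrow> 'b) \<Rightarrow> 'c" where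
  "slice r k f = (\<lambda>x. f (x(r := k)))"

lemma slice_commute: "r \<noteq> s \<Longrightarrow> slice r a (slice s b f) = slice s b (slice r a f)"
  by (auto simp: slice_def fun_upd_twist)

locale alphabet =
  fixes q :: nat
  assumes q_pos: "0 < q"
begin

text \<open>Words are functions on a finite set \<open>I\<close> of coordinates rather than lists, so that
  deleting any coordinate is as easy as deleting the first one.\<close>

definition cube :: "'a set \<Rightarrow> ('a \<Rightarrow> nat) set" where
  "cube I = I \<rightarrow>\<^sub>E {..<q}"

lemma fun_upd_in_cube: "x \<in> cube I \<or> x \<in> cube (I - {r}) \<Longrightarrow> r \<in> I \<Longrightarrow> k < q \<Longrightarrow> x(r := k) \<in> cube I"
  by (auto simp: cube_def PiE_iff extensional_def)

lemma cube_less: "x \<in> cube I \<Longrightarrow> r \<in> I \<Longrightarrow> x r < q"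
  by (auto simp: cube_def PiE_iff)

lemma undefined_upd_in_cube_Diff: "x \<in> cube I \<Longrightarrow> x(r := undefined) \<in> cube (I - {r})"
  by (auto simp: cube_def PiE_iff extensional_def)

lemma cube_eqI: "x \<in> cube I \<Longrightarrow> y \<in> cube I \<Longrightarrow> (\<And>r. r \<in> I \<Longrightarrow> x r = y r) \<Longrightarrow> x = y"
  unfolding cube_def by (rule PiE_ext)

lemma finite_cube: "finite I \<Longrightarrow> finite (cube I)"
  by (auto simp: cube_def intro: finite_PiE)

lemma card_cube: "finite I \<Longrightarrow> card (cube I) = q ^ card I"
  by (simp add: cube_def card_PiE)

lemma slice_cong:
  "(\<And>x. x \<in> cube I \<Longrightarrow> f x = g x) \<Longrightarrow> r \<in> I \<Longrightarrow> k < q \<Longrightarrow> x \<in> cube (I - {r}) \<Longrightarrow>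
     slice r k f x = slice r k g x"
  by (simp add: slice_def fun_upd_in_cube)

lemma ball_cube_slices:
  assumes "r \<in> I"
  shows "(\<forall>x\<in>cube I. P x) \<longleftrightarrow> (\<forall>k<q. \<forall>x\<in>cube (I - {r}). slice r k P x)"
proof
  assume "\<forall>x\<in>cube I. P x"
  then show "\<forall>k<q. \<forall>x\<in>cube (I - {r}). slice r k P x"
    using assms by (simp add: slice_def fun_upd_in_cube)
next
  assume slices: "\<forall>k<q. \<forall>x\<in>cube (I - {r}). slice r k P x"
  show "\<forall>x\<in>cube I. P x"
  proof
    fix x assume "x \<in> cube I"
    then have "slice r (x r) P (x(r := undefined))"
      using slices assms by (simp add: cube_less undefined_upd_in_cube_Diff)
    then show "P x" by (simp add: slice_def)
  qed
qed

lemma sum_cube_slices: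
  fixes F :: "('a \<Rightarrow> nat) \<Rightarrow> 'c :: comm_monoid_add"
  assumes "r \<in> I"
  shows "(\<Sum>x\<in>cube I. F x) = (\<Sum>k<q. \<Sum>x\<in>cube (I - {r}). slice r k F x)"
proof -
  let ?upd = "\<lambda>(k, x). x(r := k)"
  have I: "insert r (I - {r}) = I" using assms by auto
  have "cube I = ?upd ` ({..<q} \<times> cube (I - {r}))"
    using PiE_insert_eq[of r "I - {r}" "\<lambda>_. {..<q}"]
    by (simp add: cube_def I del: insert_Diff_single)
  moreover have "inj_on ?upd ({..<q} \<times> cube (I - {r}))"
    using inj_combinator[of r "I - {r}" "\<lambda>_. {..<q}"] by (simp add: cube_def)
  ultimately have "(\<Sum>x\<in>cube I. F x) = (\<Sum>p\<in>{..<q} \<times> cube (I - {r}). F (?upd p))"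
    by (simp add: sum.reindex)
  also have "\<dots> = (\<Sum>k<q. \<Sum>x\<in>cube (I - {r}). slice r k F x)"
    by (simp add: sum.cartesian_product split_def slice_def)
  finally show ?thesis .
qed

definition slices_agree :: "nat set \<Rightarrow> 'a \<Rightarrow> 'a set \<Rightarrow> (('a \<Rightarrow> nat) \<Rightarrow> 'c) \<Rightarrow> bool" where
  "slices_agree A r I f \<longleftrightarrow>
     (\<forall>k\<in>A. \<forall>m\<in>A. \<forall>x\<in>cube (I - {r}). slice r k f x = slice r m f x)"

abbreviation constant_along :: "'a \<Rightarrow> 'a set \<Rightarrow> (('a \<Rightarrow> nat) \<Rightarrow> 'c) \<Rightarrow> bool" where
  "constant_along \<equiv> slices_agree {..<q}"

lemma slices_agreeD:
  "slices_agree A r I f \<Longrightarrow> k \<in> A \<Longrightarrow> m \<in> A \<Longrightarrow> x \<in> cube (I - {r}) \<Longrightarrow> slice r k f x = slice r m f x"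
  unfolding slices_agree_def by blast

lemma constant_along_fun_upd:
  assumes "constant_along r I f" "r \<in> I" "x \<in> cube I" "k < q"
  shows "f (x(r := k)) = f x"
  using slices_agreeD[OF assms(1), of k "x r" "x(r := undefined)"] assms(2-4)
  by (simp add: cube_less undefined_upd_in_cube_Diff slice_def)

lemma constant_along_all_imp_eq:
  assumes "finite I" "\<And>r. r \<in> I \<Longrightarrow> constant_along r I f" "x \<in> cube I" "y \<in> cube I"
  shows "f x = f y"
proof -
  have "f x = f y" if "finite S" "S \<subseteq> I" "x \<in> cube I" "\<forall>r\<in>I - S. x r = y r" for S x
    using that
  proof (induction S arbitrary: x rule: finite_induct)
    case empty
    then have "x = y" using assms(4) by (auto intro: cube_eqI)
    then show ?case by simp
  next
    case (insert r S)
    have "y r < q" using cube_less[OF assms(4)] insert.prems(1) by simp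
    have "f (x(r := y r)) = f y"
    proof (rule insert.IH)
      show "x(r := y r) \<in> cube I"
        using fun_upd_in_cube[of x I r] insert.prems(1,2) \<open>y r < q\<close> by simp
      show "\<forall>s\<in>I - S. (x(r := y r)) s = y s" using insert.prems(3) by simp
    qed (use insert.prems(1) in simp)
    then show ?case
      using constant_along_fun_upd[of r I f x "y r"] insert.prems assms(2) \<open>y r < q\<close> by auto
  qed
  from this[of I x] assms show ?thesis by auto
qed

lemma constant_along_all_sum_eq_0:
  fixes f :: "('a \<Rightarrow> nat) \<Rightarrow> real"
  assumes "finite I" "\<And>r. r \<in> I \<Longrightarrow> constant_along r I f" "(\<Sum>x\<in>cube I. f x) = 0" "x \<in> cube I"
  shows "f x = 0"
proof -
  have "(\<Sum>y\<in>cube I. f y) = (\<Sum>y\<in>cube I. f x)"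
    using assms(4) by (intro sum.cong refl constant_along_all_imp_eq[OF assms(1,2)])
  then have "real (card (cube I)) * f x = 0" using assms(3) by simp
  then show ?thesis using assms(1) q_pos by (simp add: card_cube)
qed

definition vanishes_off :: "'a \<Rightarrow> nat \<Rightarrow> 'a set \<Rightarrow> (('a \<Rightarrow> nat) \<Rightarrow> 'c :: zero) \<Rightarrow> bool" where
  "vanishes_off r k I f \<longleftrightarrow> (\<forall>x\<in>cube I. x r \<noteq> k \<longrightarrow> f x = 0)"

lemma vanishes_off_iff_slices:
  assumes "r \<in> I"
  shows "vanishes_off r k I f \<longleftrightarrow> (\<forall>l<q. l \<noteq> k \<longrightarrow> (\<forall>x\<in>cube (I - {r}). slice r l f x = 0))"
  unfolding vanishes_off_def ball_cube_slices[OF assms] by (auto simp: slice_def)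

lemma vanishes_offD:
  "vanishes_off r k I f \<Longrightarrow> r \<in> I \<Longrightarrow> l < q \<Longrightarrow> l \<noteq> k \<Longrightarrow> x \<in> cube (I - {r}) \<Longrightarrow> slice r l f x = 0"
  by (simp add: vanishes_off_iff_slices)

subsection \<open>Support sizes\<close>

definition supp_card :: "'a set \<Rightarrow> (('a \<Rightarrow> nat) \<Rightarrow> 'c :: zero) \<Rightarrow> nat" where
  "supp_card I f = card {x \<in> cube I. f x \<noteq> 0}"

lemma supp_card_cong:
  "(\<And>x. x \<in> cube I \<Longrightarrow> f x = 0 \<longleftrightarrow> g x = 0) \<Longrightarrow> supp_card I f = supp_card I g"
  unfolding supp_card_def by (intro arg_cong[where f = card]) auto

lemma supp_card_eq_0_iff: "finite I \<Longrightarrow> supp_card I f = 0 \<longleftrightarrow> (\<forall>x\<in>cube I. f x = 0)"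
  unfolding supp_card_def using finite_cube by (auto simp: card_eq_0_iff)

lemma supp_card_eq_sum: "finite I \<Longrightarrow> supp_card I f = (\<Sum>x\<in>cube I. of_bool (f x \<noteq> 0))"
  unfolding supp_card_def by (simp add: finite_cube sum.If_cases of_bool_def Int_def)

lemma supp_card_slices:
  assumes "finite I" "r \<in> I"
  shows "supp_card I f = (\<Sum>k<q. supp_card (I - {r}) (slice r k f))"
  using assms(1) by (simp add: supp_card_eq_sum sum_cube_slices[OF assms(2)] slice_def)

lemma supp_card_slices_remove:
  assumes "finite I" "r \<in> I" "k < q"
  shows "supp_card I f =
    supp_card (I - {r}) (slice r k f) + (\<Sum>l\<in>{..<q} - {k}. supp_card (I - {r}) (slice r l f))"
  unfolding supp_card_slices[OF assms(1,2)] using assms(3) by (intro sum.remove) auto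

lemma supp_card_diff_le:
  fixes f g :: "('a \<Rightarrow> nat) \<Rightarrow> 'c :: group_add"
  assumes "finite I"
  shows "supp_card I (\<lambda>x. f x - g x) \<le> supp_card I f + supp_card I g"
proof -
  have "supp_card I (\<lambda>x. f x - g x) \<le> card ({x \<in> cube I. f x \<noteq> 0} \<union> {x \<in> cube I. g x \<noteq> 0})"
    unfolding supp_card_def by (rule card_mono) (use finite_cube[OF assms] in auto)
  also have "\<dots> \<le> supp_card I f + supp_card I g" unfolding supp_card_def by (rule card_Un_le)
  finally show ?thesis .
qed

lemma supp_card_vanishes_off:
  assumes "finite I" "r \<in> I" "k < q" "vanishes_off r k I f"
  shows "supp_card I f = supp_card (I - {r}) (slice r k f)"
proof -
  have "supp_card (I - {r}) (slice r l f) = 0" if "l \<in> {..<q} - {k}" for l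
    using that vanishes_offD[OF assms(4,2)] assms(1) by (simp add: supp_card_eq_0_iff)
  then show ?thesis by (simp add: supp_card_slices_remove[OF assms(1-3)])
qed

lemma supp_card_constant_along:
  assumes "finite I" "r \<in> I" "k < q" "constant_along r I f"
  shows "supp_card I f = q * supp_card (I - {r}) (slice r k f)"
proof -
  have slices: "supp_card (I - {r}) (slice r l f) = supp_card (I - {r}) (slice r k f)"
    if "l < q" for l
    using slices_agreeD[OF assms(4), of l k] that assms(3) by (intro supp_card_cong) simp
  have "supp_card I f = (\<Sum>l<q. supp_card (I - {r}) (slice r k f))"
    unfolding supp_card_slices[OF assms(1,2)] by (intro sum.cong refl slices) simp
  then show ?thesis by simp
qed

lemma supp_card_constant_along_all:
  assumes "finite I" "\<And>r. r \<in> I \<Longrightarrow> constant_along r I f" "\<exists>x\<in>cube I. f x \<noteq> 0"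
  shows "supp_card I f = q ^ card I"
proof -
  obtain x where "x \<in> cube I" "f x \<noteq> 0" using assms(3) by blast
  then have "f y \<noteq> 0" if "y \<in> cube I" for y
    using constant_along_all_imp_eq[OF assms(1,2), of y x] that by simp
  then have "{x \<in> cube I. f x \<noteq> 0} = cube I" by auto
  then show ?thesis using card_cube[OF assms(1)] by (simp add: supp_card_def)
qed

subsection \<open>Degree and orthogonality\<close>

text \<open>\<open>degree_less d I\<close> is the space \<open>U\<^bsub>[0,d-1]\<^esub>\<close>, described by vanishing mixed differences of
  order \<open>d\<close>; \<open>orthogonal_less i I\<close> is \<open>U\<^bsub>[i,n]\<^esub>\<close> with \<open>n = card I\<close>: the sum over every subcube that
  fixes fewer than \<open>i\<close> coordinates vanishes.\<close>

primrec degree_less :: "nat \<Rightarrow> 'a set \<Rightarrow> (('a \<Rightarrow> nat) \<Rightarrow> real) \<Rightarrow> bool" where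
  "degree_less 0 I f \<longleftrightarrow> (\<forall>x\<in>cube I. f x = 0)"
| "degree_less (Suc d) I f \<longleftrightarrow>
     (\<forall>r\<in>I. \<forall>k<q. \<forall>m<q. degree_less d (I - {r}) (\<lambda>x. slice r k f x - slice r m f x))"

primrec orthogonal_less :: "nat \<Rightarrow> 'a set \<Rightarrow> (('a \<Rightarrow> nat) \<Rightarrow> real) \<Rightarrow> bool" where
  "orthogonal_less 0 I f \<longleftrightarrow> True"
| "orthogonal_less (Suc i) I f \<longleftrightarrow>
     (\<Sum>x\<in>cube I. f x) = 0 \<and> (\<forall>r\<in>I. \<forall>k<q. orthogonal_less i (I - {r}) (slice r k f))"

lemma degree_less_cong:
  "(\<And>x. x \<in> cube I \<Longrightarrow> f x = g x) \<Longrightarrow> degree_less d I f = degree_less d I g"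
proof (induction d arbitrary: I f g)
  case 0
  then show ?case by simp
next
  case (Suc d)
  have "degree_less d (I - {r}) (\<lambda>x. slice r k f x - slice r m f x) =
        degree_less d (I - {r}) (\<lambda>x. slice r k g x - slice r m g x)"
    if "r \<in> I" "k < q" "m < q" for r k m
    using slice_cong[OF Suc.prems that(1)] that(2,3) by (intro Suc.IH) simp
  then show ?case by simp
qed

lemma degree_less_lincomb:
  "degree_less d I f \<Longrightarrow> degree_less d I g \<Longrightarrow> degree_less d I (\<lambda>x. a * f x + b * g x)"
proof (induction d arbitrary: I f g)
  case 0
  then show ?case by simp
next
  case (Suc d)
  have "degree_less d (I - {r})
          (\<lambda>x. a * (slice r k f x - slice r m f x) + b * (slice r k g x - slice r m g x))"
    if "r \<in> I" "k < q" "m < q" for r k m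
    using Suc.prems that by (intro Suc.IH) simp_all
  then show ?case by (simp add: slice_def algebra_simps)
qed

lemma degree_less_zero: "degree_less d I (\<lambda>x. 0)"
  by (induction d arbitrary: I) (simp_all add: slice_def)

lemma degree_less_sum:
  "(\<And>t. t \<in> A \<Longrightarrow> degree_less d I (f t)) \<Longrightarrow> degree_less d I (\<lambda>x. \<Sum>t\<in>A. f t x)"
proof (induction A rule: infinite_finite_induct)
  case (insert t A)
  then show ?case using degree_less_lincomb[of d I "f t" "\<lambda>x. \<Sum>t\<in>A. f t x" 1 1] by simp
qed (simp_all add: degree_less_zero)

lemma degree_less_slice:
  "degree_less d I f \<Longrightarrow> r \<in> I \<Longrightarrow> k < q \<Longrightarrow> degree_less d (I - {r}) (slice r k f)"
proof (induction d arbitrary: I f)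
  case 0
  then show ?case by (simp add: slice_def fun_upd_in_cube)
next
  case (Suc d)
  have "degree_less d (I - {r} - {s}) (\<lambda>x. slice s a (slice r k f) x - slice s b (slice r k f) x)"
    if "s \<in> I - {r}" "a < q" "b < q" for s a b
  proof -
    have "degree_less d (I - {s} - {r}) (slice r k (\<lambda>x. slice s a f x - slice s b f x))"
      by (rule Suc.IH) (use Suc.prems that in auto)
    moreover have "slice r k (\<lambda>x. slice s a f x - slice s b f x) =
        (\<lambda>x. slice s a (slice r k f) x - slice s b (slice r k f) x)"
      using that by (auto simp: slice_def fun_upd_twist)
    moreover have "I - {s} - {r} = I - {r} - {s}" by auto
    ultimately show ?thesis by simp
  qed
  then show ?case by simp
qed

lemma orthogonal_less_cong:
  "(\<And>x. x \<in> cube I \<Longrightarrow> f x = g x) \<Longrightarrow> orthogonal_less i I f = orthogonal_less i I g"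
proof (induction i arbitrary: I f g)
  case 0
  then show ?case by simp
next
  case (Suc i)
  have "orthogonal_less i (I - {r}) (slice r k f) = orthogonal_less i (I - {r}) (slice r k g)"
    if "r \<in> I" "k < q" for r k
    using slice_cong[OF Suc.prems that] by (intro Suc.IH)
  then show ?case using Suc.prems by simp
qed

lemma orthogonal_less_lincomb:
  "orthogonal_less i I f \<Longrightarrow> orthogonal_less i I g \<Longrightarrow> orthogonal_less i I (\<lambda>x. a * f x + b * g x)"
proof (induction i arbitrary: I f g)
  case 0
  then show ?case by simp
next
  case (Suc i)
  have "orthogonal_less i (I - {r}) (\<lambda>x. a * slice r k f x + b * slice r k g x)"
    if "r \<in> I" "k < q" for r k
    using Suc.prems that by (intro Suc.IH) simp_all
  then show ?case using Suc.prems by (simp add: slice_def sum.distrib flip: sum_distrib_left)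
qed

lemma orthogonal_less_cmult: "orthogonal_less i I f \<Longrightarrow> orthogonal_less i I (\<lambda>x. a * f x)"
  using orthogonal_less_lincomb[of i I f f a 0] by simp

lemma orthogonal_less_add:
  "orthogonal_less i I f \<Longrightarrow> orthogonal_less i I g \<Longrightarrow> orthogonal_less i I (\<lambda>x. f x + g x)"
  using orthogonal_less_lincomb[of i I f g 1 1] by simp

lemma orthogonal_less_diff:
  "orthogonal_less i I f \<Longrightarrow> orthogonal_less i I g \<Longrightarrow> orthogonal_less i I (\<lambda>x. f x - g x)"
  using orthogonal_less_lincomb[of i I f g 1 "-1"] by simp

lemma orthogonal_less_zero: "orthogonal_less i I (\<lambda>x. 0)"
  by (induction i arbitrary: I) (simp_all add: slice_def)

lemma orthogonal_less_sum:
  "(\<And>t. t \<in> A \<Longrightarrow> orthogonal_less i I (f t)) \<Longrightarrow> orthogonal_less i I (\<lambda>x. \<Sum>t\<in>A. f t x)"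
proof (induction A rule: infinite_finite_induct)
  case (insert t A)
  then show ?case by (simp add: orthogonal_less_add)
qed (simp_all add: orthogonal_less_zero)

lemma orthogonal_less_slice:
  "orthogonal_less i I f \<Longrightarrow> r \<in> I \<Longrightarrow> k < q \<Longrightarrow> orthogonal_less (i - 1) (I - {r}) (slice r k f)"
  by (cases i) simp_all

lemma orthogonal_less_sum_slices:
  "orthogonal_less i I f \<Longrightarrow> r \<in> I \<Longrightarrow> orthogonal_less i (I - {r}) (\<lambda>x. \<Sum>k<q. slice r k f x)"
proof (induction i arbitrary: I f)
  case 0
  then show ?case by simp
next
  case (Suc i)
  have "(\<Sum>x\<in>cube (I - {r}). \<Sum>k<q. slice r k f x) = (\<Sum>x\<in>cube I. f x)"
    using Suc.prems(2) by (subst sum.swap) (simp add: sum_cube_slices[of r])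
  moreover have "orthogonal_less i (I - {r} - {s}) (slice s a (\<lambda>x. \<Sum>k<q. slice r k f x))"
    if "s \<in> I - {r}" "a < q" for s a
  proof -
    have "orthogonal_less i (I - {s} - {r}) (\<lambda>x. \<Sum>k<q. slice r k (slice s a f) x)"
      by (rule Suc.IH) (use Suc.prems that in auto)
    moreover have "(\<lambda>x. \<Sum>k<q. slice r k (slice s a f) x) = slice s a (\<lambda>x. \<Sum>k<q. slice r k f x)"
      using that by (auto simp: slice_def fun_upd_twist)
    moreover have "I - {s} - {r} = I - {r} - {s}" by auto
    ultimately show ?thesis by simp
  qed
  ultimately show ?case using Suc.prems(1) by simp
qed

lemma degree_less_orthogonal_less_imp_zero:
  "finite I \<Longrightarrow> degree_less d I f \<Longrightarrow> orthogonal_less d I f \<Longrightarrow> x \<in> cube I \<Longrightarrow> f x = 0"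
proof (induction d arbitrary: I f x)
  case 0
  then show ?case by simp
next
  case (Suc d)
  have "slice r k f x - slice r m f x = 0"
    if "r \<in> I" "k < q" "m < q" "x \<in> cube (I - {r})" for r k m x
  proof (rule Suc.IH)
    show "orthogonal_less d (I - {r}) (\<lambda>x. slice r k f x - slice r m f x)"
      using Suc.prems(3) that(1-3) by (intro orthogonal_less_diff) simp_all
  qed (use Suc.prems that in auto)
  then have "constant_along r I f" if "r \<in> I" for r
    unfolding slices_agree_def using that by (metis eq_iff_diff_eq_0 lessThan_iff)
  then show ?case using constant_along_all_sum_eq_0[of I f x] Suc.prems by simp
qed

lemma orthogonal_less_antimono: "orthogonal_less i I f \<Longrightarrow> d \<le> i \<Longrightarrow> orthogonal_less d I f"
proof (induction d arbitrary: i I f)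
  case (Suc d)
  then obtain i' where "i = Suc i'" by (cases i) auto
  then show ?case using Suc.prems by (auto intro: Suc.IH[of i'])
qed simp

text \<open>Membership in \<open>U\<^bsub>[i,j]\<^esub>\<close>.\<close>

definition spectrum_between :: "nat \<Rightarrow> nat \<Rightarrow> 'a set \<Rightarrow> (('a \<Rightarrow> nat) \<Rightarrow> real) \<Rightarrow> bool" where
  "spectrum_between i j I f \<longleftrightarrow> degree_less (Suc j) I f \<and> orthogonal_less i I f"

lemma spectrum_between_cong:
  "(\<And>x. x \<in> cube I \<Longrightarrow> f x = g x) \<Longrightarrow> spectrum_between i j I f = spectrum_between i j I g"
  unfolding spectrum_between_def
  by (intro arg_cong2[where f = "(\<and>)"] degree_less_cong orthogonal_less_cong)

lemma spectrum_between_imp_le: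
  assumes "spectrum_between i j I f" "finite I" "\<exists>x\<in>cube I. f x \<noteq> 0"
  shows "i \<le> j"
proof (rule ccontr)
  assume "\<not> i \<le> j"
  then have "orthogonal_less (Suc j) I f"
    using assms(1) orthogonal_less_antimono[of i I f "Suc j"] by (simp add: spectrum_between_def)
  then show False
    using assms degree_less_orthogonal_less_imp_zero[of I "Suc j" f]
    unfolding spectrum_between_def by blast
qed

lemma spectrum_between_not_constant_along_imp_Suc:
  assumes "spectrum_between i j I f" "r \<in> I" "\<not> constant_along r I f"
  obtains j' where "j = Suc j'"
proof (cases j)
  case 0
  then have "constant_along r I f"
    using assms(1,2)
    unfolding spectrum_between_def slices_agree_def 0 degree_less.simps right_minus_eq by blast
  then show thesis using assms(3) by contradiction
qed (rule that)

lemma spectrum_between_constant_along_all_imp_0: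
  assumes "spectrum_between i j I f" "finite I" "\<And>r. r \<in> I \<Longrightarrow> constant_along r I f"
    "\<exists>x\<in>cube I. f x \<noteq> 0"
  shows "i = 0"
proof (cases i)
  case (Suc i')
  then have "(\<Sum>x\<in>cube I. f x) = 0" using assms(1) by (simp add: spectrum_between_def)
  then show ?thesis using assms(4) constant_along_all_sum_eq_0[OF assms(2,3)] by blast
qed simp

lemma spectrum_between_slice:
  assumes "spectrum_between i j I f" "r \<in> I" "k < q"
  shows "spectrum_between (i - 1) j (I - {r}) (slice r k f)"
  unfolding spectrum_between_def
  by (intro conjI degree_less_slice orthogonal_less_slice)
     (use assms in \<open>simp_all add: spectrum_between_def\<close>)

lemma spectrum_between_slice_diff:
  assumes "spectrum_between i (Suc j) I f" "r \<in> I" "k < q" "m < q"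
  shows "spectrum_between (i - 1) j (I - {r}) (\<lambda>x. slice r k f x - slice r m f x)"
proof -
  have "orthogonal_less (i - 1) (I - {r}) (\<lambda>x. slice r k f x - slice r m f x)"
    using assms unfolding spectrum_between_def
    by (intro orthogonal_less_diff orthogonal_less_slice) simp_all
  moreover have "degree_less (Suc j) (I - {r}) (\<lambda>x. slice r k f x - slice r m f x)"
    using assms by (simp add: spectrum_between_def)
  ultimately show ?thesis by (simp only: spectrum_between_def)
qed

lemma spectrum_between_vanishes_off:
  assumes "spectrum_between i (Suc j) I f" "r \<in> I" "k < q" "2 \<le> q" "vanishes_off r k I f"
  shows "spectrum_between i j (I - {r}) (slice r k f)"
  unfolding spectrum_between_def
proof
  note zero = vanishes_offD[OF assms(5,2)]
  have "(if k = 0 then 1 else 0) < q" "(if k = 0 then 1 else 0) \<noteq> k" using assms(4) by auto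
  then obtain m where m: "m < q" "m \<noteq> k" by blast
  have "degree_less (Suc j) (I - {r}) (\<lambda>x. slice r k f x - slice r m f x)"
    using spectrum_between_slice_diff[OF assms(1-3) m(1)] by (simp add: spectrum_between_def)
  then show "degree_less (Suc j) (I - {r}) (slice r k f)"
    by (rule degree_less_cong[THEN iffD1, rotated]) (simp add: zero m)
  have "(\<Sum>l<q. slice r l f x) = slice r k f x" if "x \<in> cube (I - {r})" for x
    using assms(3) that by (subst sum.remove[of _ k]) (auto simp: zero intro!: sum.neutral)
  then show "orthogonal_less i (I - {r}) (slice r k f)"
    using orthogonal_less_sum_slices[of i I f r] assms(1,2)
      orthogonal_less_cong[of "I - {r}" "\<lambda>x. \<Sum>l<q. slice r l f x" "slice r k f"]
    by (simp add: spectrum_between_def)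
qed

lemma spectrum_between_constant_along:
  assumes "spectrum_between i j I f" "r \<in> I" "k < q" "constant_along r I f"
  shows "spectrum_between i j (I - {r}) (slice r k f)"
  unfolding spectrum_between_def
proof
  show "degree_less (Suc j) (I - {r}) (slice r k f)"
    by (rule degree_less_slice) (use assms(1-3) in \<open>simp_all add: spectrum_between_def\<close>)
  have "orthogonal_less i (I - {r}) (\<lambda>x. 1 / real q * (\<Sum>l<q. slice r l f x))"
    using assms(1,2) unfolding spectrum_between_def
    by (intro orthogonal_less_cmult orthogonal_less_sum_slices) simp_all
  moreover have "1 / real q * (\<Sum>l<q. slice r l f x) = slice r k f x" if "x \<in> cube (I - {r})" for x
  proof -
    have "(\<Sum>l<q. slice r l f x) = (\<Sum>l<q. slice r k f x)"
      using assms(3) that by (intro sum.cong slices_agreeD[OF assms(4)]) simp_all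
    then show ?thesis using q_pos by simp
  qed
  ultimately show "orthogonal_less i (I - {r}) (slice r k f)"
    by (rule orthogonal_less_cong[THEN iffD1, rotated])
qed

subsection \<open>Eigenfunctions\<close>

text \<open>The inner sum includes the term \<open>k = x r\<close>, which shifts \<open>\<lambda>\<^sub>t\<close> by \<open>n\<close> to \<open>q (n - t)\<close>.\<close>

definition cube_eigenfunction :: "'a set \<Rightarrow> real \<Rightarrow> (('a \<Rightarrow> nat) \<Rightarrow> real) \<Rightarrow> bool" where
  "cube_eigenfunction I t f \<longleftrightarrow>
     (\<forall>x\<in>cube I. (\<Sum>r\<in>I. \<Sum>k<q. slice r k f x) = real q * (real (card I) - t) * f x)"

lemma cube_eigenfunction_slice:
  assumes "finite I" "r \<in> I" "cube_eigenfunction I t f" "a < q" "x \<in> cube (I - {r})"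
  shows "(\<Sum>s\<in>I - {r}. \<Sum>k<q. slice s k (slice r a f) x) =
         real q * (real (card I) - t) * slice r a f x - (\<Sum>k<q. slice r k f x)"
proof -
  have "real q * (real (card I) - t) * slice r a f x = (\<Sum>s\<in>I. \<Sum>k<q. slice s k f (x(r := a)))"
    using assms fun_upd_in_cube by (metis cube_eigenfunction_def slice_def)
  also have "\<dots> = (\<Sum>k<q. slice r k f x) + (\<Sum>s\<in>I - {r}. \<Sum>k<q. slice s k f (x(r := a)))"
    using assms(1,2) by (subst sum.remove[of I r]) (auto simp: slice_def)
  also have "(\<Sum>s\<in>I - {r}. \<Sum>k<q. slice s k f (x(r := a))) =
      (\<Sum>s\<in>I - {r}. \<Sum>k<q. slice s k (slice r a f) x)"
    by (intro sum.cong) (auto simp: slice_def fun_upd_twist)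
  finally show ?thesis by simp
qed

lemma cube_eigenfunction_slice_diff:
  assumes "finite I" "r \<in> I" "cube_eigenfunction I t f" "a < q" "b < q"
  shows "cube_eigenfunction (I - {r}) (t - 1) (\<lambda>x. slice r a f x - slice r b f x)"
  unfolding cube_eigenfunction_def
proof
  fix x assume x: "x \<in> cube (I - {r})"
  have "(\<Sum>s\<in>I - {r}. \<Sum>k<q. slice s k (\<lambda>x. slice r a f x - slice r b f x) x) =
      (\<Sum>s\<in>I - {r}. \<Sum>k<q. slice s k (slice r a f) x) - (\<Sum>s\<in>I - {r}. \<Sum>k<q. slice s k (slice r b f) x)"
    by (simp add: slice_def sum_subtractf)
  also have "\<dots> = real q * (real (card I) - t) * (slice r a f x - slice r b f x)"
    unfolding cube_eigenfunction_slice[OF assms(1-4) x] cube_eigenfunction_slice[OF assms(1-3,5) x]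
    by (simp add: algebra_simps)
  finally show "(\<Sum>s\<in>I - {r}. \<Sum>k<q. slice s k (\<lambda>x. slice r a f x - slice r b f x) x) =
      real q * (real (card (I - {r})) - (t - 1)) * (slice r a f x - slice r b f x)"
    by (simp flip: card_Suc_Diff1[OF assms(1,2)])
qed

lemma cube_eigenfunction_sum_slices:
  assumes "finite I" "r \<in> I" "cube_eigenfunction I t f"
  shows "cube_eigenfunction (I - {r}) t (\<lambda>x. \<Sum>a<q. slice r a f x)"
  unfolding cube_eigenfunction_def
proof
  fix x assume x: "x \<in> cube (I - {r})"
  let ?ev = "real q * (real (card I) - t)"
  have "(\<Sum>s\<in>I - {r}. \<Sum>k<q. slice s k (\<lambda>x. \<Sum>a<q. slice r a f x) x) =
      (\<Sum>s\<in>I - {r}. \<Sum>a<q. \<Sum>k<q. slice s k (slice r a f) x)"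
    unfolding slice_def by (intro sum.cong refl sum.swap)
  also have "\<dots> = (\<Sum>a<q. \<Sum>s\<in>I - {r}. \<Sum>k<q. slice s k (slice r a f) x)"
    by (rule sum.swap)
  also have "\<dots> = (\<Sum>a<q. ?ev * slice r a f x - (\<Sum>k<q. slice r k f x))"
    using cube_eigenfunction_slice[OF assms _ x] by simp
  also have "\<dots> = ?ev * (\<Sum>a<q. slice r a f x) - real q * (\<Sum>k<q. slice r k f x)"
    by (simp add: sum_subtractf flip: sum_distrib_left)
  also have "\<dots> = real q * (real (card (I - {r})) - t) * (\<Sum>a<q. slice r a f x)"
    unfolding card_Suc_Diff1[OF assms(1,2), symmetric] by (simp add: algebra_simps)
  finally show "(\<Sum>s\<in>I - {r}. \<Sum>k<q. slice s k (\<lambda>x. \<Sum>a<q. slice r a f x) x) = \<dots>" .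
qed

lemma cube_eigenfunction_neg_imp_zero:
  "finite I \<Longrightarrow> cube_eigenfunction I t f \<Longrightarrow> t < 0 \<Longrightarrow> x \<in> cube I \<Longrightarrow> f x = 0"
proof (induction I arbitrary: t f x rule: finite_psubset_induct)
  case (psubset I)
  have "slice r k f y - slice r m f y = 0"
    if "r \<in> I" "k < q" "m < q" "y \<in> cube (I - {r})" for r k m y
    by (rule psubset.IH[OF _ cube_eigenfunction_slice_diff[OF psubset.hyps that(1) psubset.prems(1)]])
       (use psubset.prems that in auto)
  then have "constant_along r I f" if "r \<in> I" for r
    unfolding slices_agree_def using that by (metis eq_iff_diff_eq_0 lessThan_iff)
  then have "(\<Sum>r\<in>I. \<Sum>k<q. slice r k f x) = (\<Sum>r\<in>I. \<Sum>k<q. f x)"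
    using psubset.prems(3)
    by (intro sum.cong refl) (simp add: slice_def constant_along_fun_upd[of _ I])
  moreover have "(\<Sum>r\<in>I. \<Sum>k<q. slice r k f x) = real q * (real (card I) - t) * f x"
    using psubset.prems by (simp add: cube_eigenfunction_def)
  ultimately have "real q * t * f x = 0" by (simp add: algebra_simps)
  then show ?case using psubset.prems(2) q_pos by simp
qed

lemma cube_eigenfunction_imp_degree_less:
  "finite I \<Longrightarrow> cube_eigenfunction I t f \<Longrightarrow> t < real d \<Longrightarrow> degree_less d I f"
proof (induction d arbitrary: I t f)
  case 0
  then show ?case using cube_eigenfunction_neg_imp_zero[of I t f] by simp
next
  case (Suc d)
  have "degree_less d (I - {r}) (\<lambda>x. slice r k f x - slice r m f x)"
    if "r \<in> I" "k < q" "m < q" for r k m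
    using Suc.prems that by (intro Suc.IH[OF _ cube_eigenfunction_slice_diff]) auto
  then show ?case by simp
qed

lemma cube_eigenfunction_sum_eq_0:
  assumes "finite I" "cube_eigenfunction I t f" "t \<noteq> 0"
  shows "(\<Sum>x\<in>cube I. f x) = 0"
proof -
  let ?S = "\<Sum>x\<in>cube I. f x"
  have slices: "(\<Sum>x\<in>cube I. \<Sum>k<q. slice r k f x) = real q * ?S" if "r \<in> I" for r
    using sum.swap[of "\<lambda>x k. slice r k f x" "{..<q}" "cube (I - {r})"]
    by (simp add: sum_cube_slices[OF that] slice_def)
  have "real q * (real (card I) - t) * ?S = (\<Sum>x\<in>cube I. \<Sum>r\<in>I. \<Sum>k<q. slice r k f x)"
    using assms(2) by (simp add: cube_eigenfunction_def sum_distrib_left)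
  also have "\<dots> = (\<Sum>r\<in>I. \<Sum>x\<in>cube I. \<Sum>k<q. slice r k f x)" by (rule sum.swap)
  also have "\<dots> = real (card I) * real q * ?S" by (simp add: slices)
  finally have "real q * t * ?S = 0" by (simp add: algebra_simps)
  then show ?thesis using assms(3) q_pos by simp
qed

lemma cube_eigenfunction_imp_orthogonal_less:
  "finite I \<Longrightarrow> cube_eigenfunction I t f \<Longrightarrow> real i \<le> t \<Longrightarrow> orthogonal_less i I f"
proof (induction i arbitrary: I t f)
  case 0
  then show ?case by simp
next
  case (Suc i)
  have "orthogonal_less i (I - {r}) (slice r k f)" if r: "r \<in> I" and k: "k < q" for r k
  proof -
    have "orthogonal_less i (I - {r}) (\<lambda>x. \<Sum>a<q. slice r a f x)"
      using Suc.prems r by (intro Suc.IH[OF _ cube_eigenfunction_sum_slices]) auto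
    moreover have "orthogonal_less i (I - {r}) (\<lambda>x. \<Sum>m<q. slice r k f x - slice r m f x)"
      using Suc.prems r k
      by (intro orthogonal_less_sum Suc.IH[OF _ cube_eigenfunction_slice_diff]) auto
    ultimately have "orthogonal_less i (I - {r})
        (\<lambda>x. 1 / real q * ((\<Sum>a<q. slice r a f x) + (\<Sum>m<q. slice r k f x - slice r m f x)))"
      by (intro orthogonal_less_cmult orthogonal_less_add)
    also have "(\<lambda>x. 1 / real q * ((\<Sum>a<q. slice r a f x) + (\<Sum>m<q. slice r k f x - slice r m f x))) =
        slice r k f"
      using q_pos by (simp add: sum_subtractf)
    finally show ?thesis .
  qed
  moreover have "(\<Sum>x\<in>cube I. f x) = 0" using cube_eigenfunction_sum_eq_0 Suc.prems by fastforce
  ultimately show ?case by simp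
qed

lemma sum_cube_eigenfunctions_spectrum_between:
  assumes "finite I" "\<And>t. t \<in> {i..j} \<Longrightarrow> cube_eigenfunction I (real t) (g t)"
  shows "spectrum_between i j I (\<lambda>x. \<Sum>t=i..j. g t x)"
  unfolding spectrum_between_def
proof
  show "degree_less (Suc j) I (\<lambda>x. \<Sum>t=i..j. g t x)"
    by (intro degree_less_sum cube_eigenfunction_imp_degree_less[OF assms]) auto
  show "orthogonal_less i I (\<lambda>x. \<Sum>t=i..j. g t x)"
    by (intro orthogonal_less_sum cube_eigenfunction_imp_orthogonal_less[OF assms]) auto
qed

end

subsection \<open>The lower bound\<close>

locale large_alphabet = alphabet +
  assumes q_ge_3: "3 \<le> q"
begin

lemma other_symbol:
  obtains l where "l < q" "l \<noteq> k" "l \<noteq> m"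
proof -
  have "card {k, m} < card {..<q}" using q_ge_3 card_insert_le_m1[of 2 "{m}" k] by simp
  then have "\<not> {..<q} \<subseteq> {k, m}" using card_mono[of "{k, m}" "{..<q}"] by auto
  then show thesis using that by auto
qed

definition min_supp :: "nat \<Rightarrow> nat \<Rightarrow> nat \<Rightarrow> nat" where
  "min_supp n i j = 2 ^ i * (q - 1) ^ i * q ^ (n - i - j)"

lemma min_supp_pos: "0 < min_supp n i j"
  using q_ge_3 by (simp add: min_supp_def)

lemma min_supp_Suc_n_Suc_j: "min_supp (Suc n) i (Suc j) = min_supp n i j"
proof -
  have "Suc n - i - Suc j = n - i - j" by arith
  then show ?thesis by (simp only: min_supp_def)
qed

lemma min_supp_Suc_n_Suc_i: "min_supp (Suc n) (Suc i) j = 2 * (q - 1) * min_supp n i j"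
  by (simp add: min_supp_def mult_ac)

lemma min_supp_Suc_n: "i + j \<le> n \<Longrightarrow> min_supp (Suc n) i j = q * min_supp n i j"
  by (simp add: min_supp_def Suc_diff_le mult_ac)

lemma mult_min_supp_le:
  assumes "i + Suc j \<le> Suc n"
  shows "q * min_supp (Suc n) i (Suc j) \<le> 2 * (q - 1) * min_supp n (i - 1) j"
proof (cases i)
  case 0
  have "q \<le> 2 * (q - 1)" using q_ge_3 by linarith
  then show ?thesis unfolding 0 by (simp only: min_supp_Suc_n_Suc_j mult_le_mono1 zero_diff)
next
  case (Suc i')
  then have "q * min_supp (Suc n) i (Suc j) = 2 * (q - 1) * (q * min_supp n i' (Suc j))"
    by (simp add: min_supp_Suc_n_Suc_i)
  also have "q * min_supp n i' (Suc j) = min_supp n i' j"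
    using min_supp_Suc_n[of i' "Suc j" n] assms Suc by (simp add: min_supp_Suc_n_Suc_j)
  finally show ?thesis by (simp add: Suc)
qed

text \<open>With \<open>m\<close> of least size \<open>S (F m)\<close>, two further members distinct from \<open>F m\<close> force the sum
  \<open>T\<close> to satisfy \<open>T + S (F m) \<ge> 2 B\<close>, while \<open>T \<ge> q S (F m)\<close> always.\<close>

lemma all_but_one_equal_or_large_sum:
  fixes F :: "nat \<Rightarrow> 'b" and S :: "'b \<Rightarrow> nat"
  assumes "0 < B"
    and pair: "\<And>k m. k < q \<Longrightarrow> m < q \<Longrightarrow> F k \<noteq> F m \<Longrightarrow> B \<le> S (F k) + S (F m)"
    and distinct: "k\<^sub>0 < q" "m\<^sub>0 < q" "F k\<^sub>0 \<noteq> F m\<^sub>0"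
  obtains (large) "2 * (q - 1) * B < q * (\<Sum>k<q. S (F k))"
    | (all_but_one) k m where "k < q" "\<forall>l<q. l \<noteq> k \<longrightarrow> F l = F m"
proof -
  obtain m where m: "m < q" and least: "\<And>l. l < q \<Longrightarrow> S (F m) \<le> S (F l)"
    using ex_has_least_nat[of "\<lambda>l. l < q" 0 "\<lambda>l. S (F l)"] q_pos by auto
  obtain k where k: "k < q" "F k \<noteq> F m" using distinct by metis
  show thesis
  proof (cases "\<forall>l<q. l \<noteq> k \<longrightarrow> F l = F m")
    case True
    then show thesis using all_but_one k by blast
  next
    case False
    then obtain l where l: "l < q" "l \<noteq> k" "F l \<noteq> F m" by blast
    let ?T = "\<Sum>k<q. S (F k)"
    have min: "q * S (F m) \<le> ?T"
      using sum_bounded_below[of "{..<q}" "S (F m)" "\<lambda>l. S (F l)"] least by simp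
    have "k \<noteq> l" "k \<noteq> m" "l \<noteq> m" using k l by auto
    then have "S (F k) + S (F l) + S (F m) = (\<Sum>p\<in>{k, l, m}. S (F p))" by simp
    also have "\<dots> \<le> ?T" by (rule sum_mono2) (use k l m in auto)
    finally have three: "2 * B \<le> ?T + S (F m)"
      using pair[OF k(1) m k(2)] pair[OF l(1) m l(3)] by linarith
    have "2 * (q - 1) * B < 2 * (q * B)" using \<open>0 < B\<close> q_pos by simp
    moreover have "2 * (q * B) \<le> q * ?T + q * S (F m)"
      using mult_le_mono2[OF three, of q] by (simp add: algebra_simps)
    moreover have "2 * (q * B) = 2 * (q - 1) * B + 2 * B" using q_pos by (cases q) simp_all
    moreover have "2 * (q * B) \<le> q * ?T" if "2 * B \<le> q * S (F m)"
      using mult_le_mono2[OF order_trans[OF that min], of q] by (simp add: algebra_simps)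
    ultimately have "2 * (q - 1) * B < q * ?T" by (cases "2 * B \<le> q * S (F m)") linarith+
    then show thesis by (rule large)
  qed
qed

lemma slices_agree_or_large_supp:
  fixes f :: "('a \<Rightarrow> nat) \<Rightarrow> 'c :: zero"
  assumes "0 < B" and fin: "finite I" and r: "r \<in> I" "\<not> constant_along r I f"
    and pair: "\<And>k m x. k < q \<Longrightarrow> m < q \<Longrightarrow> x \<in> cube (I - {r}) \<Longrightarrow> slice r k f x \<noteq> slice r m f x \<Longrightarrow>
      B \<le> supp_card (I - {r}) (slice r k f) + supp_card (I - {r}) (slice r m f)"
  obtains (large) "2 * (q - 1) * B < q * supp_card I f"
    | (agree) k where "k < q" "slices_agree ({..<q} - {k}) r I f"
proof -
  define F where "F k = restrict (slice r k f) (cube (I - {r}))" for k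
  have F_eq: "F k = F m \<longleftrightarrow> (\<forall>x\<in>cube (I - {r}). slice r k f x = slice r m f x)" for k m
    by (auto simp: F_def restrict_def fun_eq_iff)
  have supp_F: "supp_card (I - {r}) (F k) = supp_card (I - {r}) (slice r k f)" for k
    by (rule supp_card_cong) (simp add: F_def)
  obtain k\<^sub>0 m\<^sub>0 where distinct: "k\<^sub>0 < q" "m\<^sub>0 < q" "F k\<^sub>0 \<noteq> F m\<^sub>0"
    using r(2) unfolding slices_agree_def F_eq by blast
  have pair_F: "B \<le> supp_card (I - {r}) (F k) + supp_card (I - {r}) (F m)"
    if "k < q" "m < q" "F k \<noteq> F m" for k m
    using pair that unfolding F_eq supp_F by blast
  consider (large_sum) "2 * (q - 1) * B < q * (\<Sum>k<q. supp_card (I - {r}) (F k))"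
    | (all_but_one) k m where "k < q" "\<forall>l<q. l \<noteq> k \<longrightarrow> F l = F m"
    by (rule all_but_one_equal_or_large_sum[where F = F and S = "supp_card (I - {r})",
        OF \<open>0 < B\<close> pair_F distinct])
  then show thesis
  proof cases
    case large_sum
    then show thesis
      unfolding supp_F by (intro large) (simp add: supp_card_slices[OF fin r(1)])
  next
    case (all_but_one k m)
    then have "F l = F l'" if "l \<in> {..<q} - {k}" "l' \<in> {..<q} - {k}" for l l'
      using that by (metis Diff_iff lessThan_iff singletonI)
    then have "slices_agree ({..<q} - {k}) r I f" unfolding slices_agree_def F_eq by blast
    then show thesis using all_but_one(1) by (intro agree)
  qed
qed

lemma supp_card_slices_agree:
  assumes "finite I" "r \<in> I" "k < q" "m < q" "m \<noteq> k" "slices_agree ({..<q} - {k}) r I f"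
  shows "supp_card I f =
    supp_card (I - {r}) (slice r k f) + (q - 1) * supp_card (I - {r}) (slice r m f)"
proof -
  have "supp_card (I - {r}) (slice r l f) = supp_card (I - {r}) (slice r m f)"
    if "l \<in> {..<q} - {k}" for l
    using slices_agreeD[OF assms(6) that, of m] assms(4,5) by (intro supp_card_cong) simp
  then have "(\<Sum>l\<in>{..<q} - {k}. supp_card (I - {r}) (slice r l f)) =
      (\<Sum>l\<in>{..<q} - {k}. supp_card (I - {r}) (slice r m f))"
    by (intro sum.cong refl)
  then show ?thesis using supp_card_slices_remove[OF assms(1-3), of f] assms(3) by simp
qed

lemma slices_agree_not_constant_along:
  assumes "slices_agree ({..<q} - {k}) r I f" "\<not> constant_along r I f" "m < q" "m \<noteq> k"
  obtains x where "x \<in> cube (I - {r})" "slice r k f x \<noteq> slice r m f x"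
proof -
  have off_k: "slice r l f x = slice r m f x" if "l < q" "l \<noteq> k" "x \<in> cube (I - {r})" for l x
    using slices_agreeD[OF assms(1), of l m x] that assms(3,4) by simp
  obtain l l' x where "l < q" "l' < q" "x \<in> cube (I - {r})" "slice r l f x \<noteq> slice r l' f x"
    using assms(2) unfolding slices_agree_def by blast
  then have "slice r k f x \<noteq> slice r m f x"
    using off_k[of l x] off_k[of l' x] by (cases "l = k"; cases "l' = k") auto
  then show thesis using \<open>x \<in> cube (I - {r})\<close> that by blast
qed

definition supp_bounded_below :: "'a set \<Rightarrow> bool" where
  "supp_bounded_below I \<longleftrightarrow> (\<forall>i j f. i + j \<le> card I \<longrightarrow> spectrum_between i j I f \<longrightarrow>
     (\<exists>x\<in>cube I. f x \<noteq> 0) \<longrightarrow> min_supp (card I) i j \<le> supp_card I f)"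

lemma supp_bounded_belowD:
  "supp_bounded_below I \<Longrightarrow> i + j \<le> card I \<Longrightarrow> spectrum_between i j I f \<Longrightarrow> \<exists>x\<in>cube I. f x \<noteq> 0 \<Longrightarrow>
     min_supp (card I) i j \<le> supp_card I f"
  unfolding supp_bounded_below_def by blast

lemma supp_card_slice_pair_ge:
  assumes "supp_bounded_below (I - {r})" "finite I" "r \<in> I"
    and "spectrum_between i (Suc j) I f" "i + Suc j \<le> card I"
    and "k < q" "m < q" "x \<in> cube (I - {r})" "slice r k f x \<noteq> slice r m f x"
  shows "min_supp (card (I - {r})) (i - 1) j \<le>
    supp_card (I - {r}) (slice r k f) + supp_card (I - {r}) (slice r m f)"
proof -
  have "i - 1 + j \<le> card (I - {r})" using card_Suc_Diff1[OF assms(2,3)] assms(5) by linarith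
  then have "min_supp (card (I - {r})) (i - 1) j \<le>
      supp_card (I - {r}) (\<lambda>x. slice r k f x - slice r m f x)"
    by (rule supp_bounded_belowD[OF assms(1) _ spectrum_between_slice_diff[OF assms(4,3,6,7)]])
       (use assms(8,9) in auto)
  also have "\<dots> \<le> supp_card (I - {r}) (slice r k f) + supp_card (I - {r}) (slice r m f)"
    using assms(2) by (intro supp_card_diff_le) simp
  finally show ?thesis .
qed

lemma slices_agree_cases:
  assumes bnd: "supp_bounded_below (I - {r})" and fin: "finite I"
    and r: "r \<in> I" "\<not> constant_along r I f"
    and spec: "spectrum_between i (Suc j) I f" and ij: "i + Suc j \<le> card I"
    and agree: "k < q" "slices_agree ({..<q} - {k}) r I f" and nonzero: "\<not> vanishes_off r k I f"
  obtains (large) "min_supp (card I) i (Suc j) < supp_card I f"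
    | (splitting) i' where "i = Suc i'"
      "\<And>l. l < q \<Longrightarrow> l \<noteq> k \<Longrightarrow> min_supp (card (I - {r})) i' (Suc j) \<le> supp_card (I - {r}) (slice r l f)"
      "\<And>l. l < q \<Longrightarrow> l \<noteq> k \<Longrightarrow> q * min_supp (card (I - {r})) i' (Suc j) \<le>
         supp_card (I - {r}) (slice r k f) + supp_card (I - {r}) (slice r l f)"
proof -
  let ?J = "I - {r}"
  let ?supp = "\<lambda>l. supp_card ?J (slice r l f)"
  have card: "card I = Suc (card ?J)" using card_Suc_Diff1[OF fin r(1)] by simp
  have slice_nonzero: "\<exists>x\<in>cube ?J. slice r l f x \<noteq> 0" if l: "l < q" "l \<noteq> k" for l
  proof -
    obtain m x where "m < q" "m \<noteq> k" "x \<in> cube ?J" "slice r m f x \<noteq> 0"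
      using nonzero unfolding vanishes_off_iff_slices[OF r(1)] by blast
    then show ?thesis using slices_agreeD[OF agree(2), of l m x] l by (intro bexI[of _ x]) simp_all
  qed
  have pair: "min_supp (card ?J) (i - 1) j \<le> ?supp k + ?supp l" if l: "l < q" "l \<noteq> k" for l
  proof -
    obtain x where x: "x \<in> cube ?J" "slice r k f x \<noteq> slice r l f x"
      using slices_agree_not_constant_along[OF agree(2) r(2) l] .
    show ?thesis by (rule supp_card_slice_pair_ge[OF bnd fin r(1) spec ij agree(1) l(1) x])
  qed
  show thesis
  proof (cases i)
    case 0
    obtain m where m: "m < q" "m \<noteq> k" using other_symbol by blast
    have "0 < ?supp m" using slice_nonzero[OF m] fin supp_card_eq_0_iff[of ?J "slice r m f"] by auto
    then have "?supp m < (q - 1) * ?supp m" using q_ge_3 by simp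
    then have "min_supp (card ?J) 0 j < supp_card I f"
      using pair[OF m] supp_card_slices_agree[OF fin r(1) agree(1) m agree(2)]
      unfolding 0 zero_diff by linarith
    then show thesis by (intro large) (simp add: card 0 min_supp_Suc_n_Suc_j)
  next
    case (Suc i')
    have i'j: "i' + Suc j \<le> card ?J" using ij card Suc by simp
    have "min_supp (card ?J) i' (Suc j) \<le> ?supp l" if l: "l < q" "l \<noteq> k" for l
      using supp_bounded_belowD[OF bnd i'j] spectrum_between_slice[OF spec r(1) l(1)]
        slice_nonzero[OF l]
      by (simp add: Suc)
    moreover have "min_supp (card ?J) i' j = q * min_supp (card ?J) i' (Suc j)"
      using min_supp_Suc_n[OF i'j] by (simp add: min_supp_Suc_n_Suc_j)
    ultimately show thesis using pair by (intro splitting[OF Suc]) (simp_all add: Suc)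
  qed
qed

lemma nonconstant_slices_cases:
  assumes bnd: "supp_bounded_below (I - {r})" and fin: "finite I"
    and r: "r \<in> I" "\<not> constant_along r I f"
    and spec: "spectrum_between i j I f" and ij: "i + j \<le> card I"
  obtains (large) "min_supp (card I) i j < supp_card I f"
    | (vanishing) k where "k < q" "vanishes_off r k I f"
    | (splitting) k i' j' where "k < q" "i = Suc i'" "j = Suc j'" "slices_agree ({..<q} - {k}) r I f"
      "\<And>l. l < q \<Longrightarrow> l \<noteq> k \<Longrightarrow> min_supp (card (I - {r})) i' j \<le> supp_card (I - {r}) (slice r l f)"
      "\<And>l. l < q \<Longrightarrow> l \<noteq> k \<Longrightarrow> q * min_supp (card (I - {r})) i' j \<le>
         supp_card (I - {r}) (slice r k f) + supp_card (I - {r}) (slice r l f)"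
proof -
  let ?J = "I - {r}"
  have card: "card I = Suc (card ?J)" using card_Suc_Diff1[OF fin r(1)] by simp
  obtain j' where j': "j = Suc j'"
    using spectrum_between_not_constant_along_imp_Suc[OF spec r] .
  note spec' = spec[unfolded j'] and ij' = ij[unfolded j']
  consider (large_supp) "2 * (q - 1) * min_supp (card ?J) (i - 1) j' < q * supp_card I f"
    | (agree) k where "k < q" "slices_agree ({..<q} - {k}) r I f"
    by (rule slices_agree_or_large_supp[OF min_supp_pos fin r
          supp_card_slice_pair_ge[OF bnd fin r(1) spec' ij']])
  then show thesis
  proof cases
    case large_supp
    then have "q * min_supp (card I) i j < q * supp_card I f"
      using mult_min_supp_le[of i j' "card ?J"] ij unfolding card j' by linarith
    then show thesis using large by simp
  next
    case (agree k)
    show thesis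
    proof (cases "vanishes_off r k I f")
      case True
      then show thesis using vanishing agree(1) by blast
    next
      case False
      from bnd fin r spec' ij' agree this show thesis
      proof (cases rule: slices_agree_cases)
        case large
        then show thesis using that(1) by (simp add: j')
      next
        case (splitting i')
        then show thesis using that(3)[OF agree(1) splitting(1) j' agree(2)] by (simp add: j')
      qed
    qed
  qed
qed

lemma supp_card_vanishes_off_ge:
  assumes bnd: "supp_bounded_below (I - {r})" and fin: "finite I" and r: "r \<in> I" "k < q"
    and spec: "spectrum_between i (Suc j) I f" and ij: "i + Suc j \<le> card I"
    and vanish: "vanishes_off r k I f" and nonzero: "\<exists>x\<in>cube I. f x \<noteq> 0"
  shows "min_supp (card I) i (Suc j) \<le> supp_card I f"
proof -
  let ?J = "I - {r}"
  have card: "card I = Suc (card ?J)" using card_Suc_Diff1[OF fin r(1)] by simp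
  have supp: "supp_card I f = supp_card ?J (slice r k f)"
    by (rule supp_card_vanishes_off[OF fin r vanish])
  have "supp_card I f \<noteq> 0" using nonzero fin by (simp add: supp_card_eq_0_iff)
  then have "\<exists>x\<in>cube ?J. slice r k f x \<noteq> 0"
    using supp fin supp_card_eq_0_iff[of ?J "slice r k f"] by auto
  moreover have "spectrum_between i j ?J (slice r k f)"
    using spec r vanish q_ge_3 by (intro spectrum_between_vanishes_off) simp_all
  moreover have "i + j \<le> card ?J" using ij card by simp
  ultimately show ?thesis
    using supp_bounded_belowD[OF bnd] by (simp add: supp card min_supp_Suc_n_Suc_j)
qed

lemma splitting_sum_ge:
  fixes \<beta> s t :: nat
  assumes "\<beta> \<le> s" "q * \<beta> \<le> t + s"
  shows "2 * (q - 1) * \<beta> \<le> t + (q - 1) * s"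
    and "t + (q - 1) * s = 2 * (q - 1) * \<beta> \<Longrightarrow> s = \<beta> \<and> t = (q - 1) * \<beta>"
proof -
  have "q = Suc (Suc (q - 2))" "0 < q - 2" using q_ge_3 by simp_all
  then obtain p where p: "q = Suc (Suc p)" "0 < p" by blast
  have le: "p * \<beta> \<le> p * s" using assms(1) by simp
  have total: "t + (q - 1) * s = (t + s) + p * s" and bound: "2 * (q - 1) * \<beta> = q * \<beta> + p * \<beta>"
    by (simp_all add: p algebra_simps)
  show "2 * (q - 1) * \<beta> \<le> t + (q - 1) * s" using assms(2) le total bound by linarith
  assume "t + (q - 1) * s = 2 * (q - 1) * \<beta>"
  then have "p * s = p * \<beta>" "t + s = q * \<beta>" using assms(2) le total bound by linarith+
  then show "s = \<beta> \<and> t = (q - 1) * \<beta>" using p by (simp add: algebra_simps)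
qed

text \<open>Slicing along a coordinate in which \<open>f\<close> is constant would leave the range \<open>i + j \<le> n\<close> when
  \<open>i + j = n\<close>; hence a nonconstant coordinate is chosen.\<close>

theorem finite_imp_supp_bounded_below: "finite I \<Longrightarrow> supp_bounded_below I"
proof (induction I rule: finite_psubset_induct)
  case (psubset I)
  show ?case unfolding supp_bounded_below_def
  proof (intro allI impI)
    fix i j f
    assume ij: "i + j \<le> card I" and spec: "spectrum_between i j I f"
      and nonzero: "\<exists>x\<in>cube I. f x \<noteq> 0"
    show "min_supp (card I) i j \<le> supp_card I f"
    proof (cases "\<forall>r\<in>I. constant_along r I f")
      case True
      then have "i = 0" "supp_card I f = q ^ card I"
        using spectrum_between_constant_along_all_imp_0[OF spec psubset.hyps] nonzero
          supp_card_constant_along_all[OF psubset.hyps, of f] by blast+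
      then show ?thesis using q_pos by (simp add: min_supp_def power_increasing)
    next
      case False
      then obtain r where r: "r \<in> I" "\<not> constant_along r I f" by blast
      let ?J = "I - {r}"
      have card: "card I = Suc (card ?J)" using card_Suc_Diff1[OF psubset.hyps r(1)] by simp
      have bnd: "supp_bounded_below ?J" using psubset.IH r(1) by blast
      from bnd psubset.hyps r spec ij show ?thesis
      proof (cases rule: nonconstant_slices_cases)
        case large
        then show ?thesis by simp
      next
        case (vanishing k)
        obtain j' where j': "j = Suc j'"
          using spectrum_between_not_constant_along_imp_Suc[OF spec r] .
        show ?thesis
          using supp_card_vanishes_off_ge[OF bnd psubset.hyps r(1) vanishing(1) _ _ vanishing(2) nonzero]
            spec ij by (simp add: j')
      next
        case (splitting k i' j')
        obtain m where m: "m < q" "m \<noteq> k" using other_symbol by blast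
        show ?thesis
          using splitting_sum_ge(1)[OF splitting(5,6)[OF m]]
            supp_card_slices_agree[OF psubset.hyps r(1) splitting(1) m splitting(4)]
          by (simp add: card splitting(2) min_supp_Suc_n_Suc_i)
      qed
    qed
  qed
qed

subsection \<open>Slices of extremal functions\<close>

definition extremal :: "nat \<Rightarrow> nat \<Rightarrow> 'a set \<Rightarrow> (('a \<Rightarrow> nat) \<Rightarrow> real) \<Rightarrow> bool" where
  "extremal i j I f \<longleftrightarrow>
     i + j \<le> card I \<and> spectrum_between i j I f \<and> supp_card I f = min_supp (card I) i j"

lemma extremalD:
  assumes "extremal i j I f"
  shows "i + j \<le> card I" and "spectrum_between i j I f" and "supp_card I f = min_supp (card I) i j"
  using assms unfolding extremal_def by blast+

lemma extremal_nonzero: "extremal i j I f \<Longrightarrow> finite I \<Longrightarrow> \<exists>x\<in>cube I. f x \<noteq> 0"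
  using min_supp_pos[of "card I" i j] supp_card_eq_0_iff[of I f] by (auto simp: extremal_def)

text \<open>The model is \<open>a\<^sub>1(k,m) u\<close> with \<open>|u| = \<beta>\<close>, sliced along one of its first two coordinates.\<close>

definition splits_along :: "nat \<Rightarrow> 'a \<Rightarrow> nat \<Rightarrow> 'a set \<Rightarrow> (('a \<Rightarrow> nat) \<Rightarrow> 'c :: zero) \<Rightarrow> bool" where
  "splits_along \<beta> r k I f \<longleftrightarrow> slices_agree ({..<q} - {k}) r I f \<and>
     supp_card (I - {r}) (slice r k f) = (q - 1) * \<beta> \<and>
     (\<forall>l<q. l \<noteq> k \<longrightarrow> supp_card (I - {r}) (slice r l f) = \<beta>)"

lemma splits_alongD:
  assumes "splits_along \<beta> r k I f"
  shows "slices_agree ({..<q} - {k}) r I f"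
    and "supp_card (I - {r}) (slice r k f) = (q - 1) * \<beta>"
    and "l < q \<Longrightarrow> l \<noteq> k \<Longrightarrow> supp_card (I - {r}) (slice r l f) = \<beta>"
  using assms unfolding splits_along_def by blast+

lemma extremal_cases:
  assumes ext: "extremal i j I f" and fin: "finite I" and r: "r \<in> I" "\<not> constant_along r I f"
  obtains (vanishing) k where "k < q" "vanishes_off r k I f"
    | (splitting) k i' j' where "k < q" "i = Suc i'" "j = Suc j'"
      "splits_along (min_supp (card (I - {r})) i' j) r k I f"
proof -
  let ?J = "I - {r}"
  have card: "card I = Suc (card ?J)" using card_Suc_Diff1[OF fin r(1)] by simp
  have bnd: "supp_bounded_below ?J" using fin by (intro finite_imp_supp_bounded_below) simp
  from bnd fin r extremalD(2,1)[OF ext] show thesis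
  proof (cases rule: nonconstant_slices_cases)
    case large
    then show thesis using extremalD(3)[OF ext] by simp
  next
    case (vanishing k)
    then show thesis by (rule that(1))
  next
    case (splitting k i' j')
    let ?\<beta> = "min_supp (card ?J) i' j"
    have "supp_card ?J (slice r l f) = ?\<beta> \<and> supp_card ?J (slice r k f) = (q - 1) * ?\<beta>"
      if l: "l < q" "l \<noteq> k" for l
      using splitting_sum_ge(2)[OF splitting(5,6)[OF l]] extremalD(3)[OF ext]
        supp_card_slices_agree[OF fin r(1) splitting(1) l splitting(4)]
      by (simp add: card splitting(2) min_supp_Suc_n_Suc_i)
    moreover obtain m where "m < q" "m \<noteq> k" using other_symbol by blast
    ultimately have "splits_along ?\<beta> r k I f"
      unfolding splits_along_def using splitting(4) by blast
    then show thesis using splitting(1-3) that(2) by blast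
  qed
qed

lemma extremal_vanishes_off:
  assumes ext: "extremal i j I f" and fin: "finite I" and r: "r \<in> I" "k < q" "vanishes_off r k I f"
  obtains j' where "j = Suc j'" "extremal i j' (I - {r}) (slice r k f)"
proof -
  let ?J = "I - {r}"
  have card: "card I = Suc (card ?J)" using card_Suc_Diff1[OF fin r(1)] by simp
  have "\<not> constant_along r I f"
  proof
    assume const: "constant_along r I f"
    obtain m where m: "m < q" "m \<noteq> k" using other_symbol by blast
    have "supp_card ?J (slice r m f) = 0"
      using vanishes_offD[OF r(3,1) m] fin by (simp add: supp_card_eq_0_iff)
    then have "supp_card I f = 0" using supp_card_constant_along[OF fin r(1) m(1) const] by simp
    then show False using extremal_nonzero[OF ext fin] fin by (simp add: supp_card_eq_0_iff)
  qed
  then obtain j' where j': "j = Suc j'"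
    using spectrum_between_not_constant_along_imp_Suc[OF extremalD(2)[OF ext] r(1)] by blast
  have "spectrum_between i j' ?J (slice r k f)"
    using extremalD(2)[OF ext] r q_ge_3 by (intro spectrum_between_vanishes_off) (simp_all add: j')
  then have "extremal i j' ?J (slice r k f)"
    using extremalD(1,3)[OF ext] supp_card_vanishes_off[OF fin r]
    by (simp add: extremal_def card j' min_supp_Suc_n_Suc_j)
  then show thesis using j' that by blast
qed

lemma extremal_constant_along:
  assumes ext: "extremal i j I f" and fin: "finite I" and r: "r \<in> I" "k < q"
    and const: "constant_along r I f" and ij: "i + j < card I"
  shows "extremal i j (I - {r}) (slice r k f)"
proof -
  have card: "card I = Suc (card (I - {r}))" using card_Suc_Diff1[OF fin r(1)] by simp
  then have ij': "i + j \<le> card (I - {r})" using ij by simp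
  have "q * supp_card (I - {r}) (slice r k f) = q * min_supp (card (I - {r})) i j"
    using ext supp_card_constant_along[OF fin r const]
    by (simp add: extremal_def card min_supp_Suc_n[OF ij'])
  then show ?thesis
    using ext spectrum_between_constant_along[OF _ r const] ij' q_pos by (simp add: extremal_def)
qed

lemma extremal_equal_slices_imp_constant_along:
  assumes ext: "extremal i j I f" and fin: "finite I" and r: "r \<in> I"
    and equal: "\<And>k. k < q \<Longrightarrow> supp_card (I - {r}) (slice r k f) = \<gamma>"
  shows "constant_along r I f"
proof (rule ccontr)
  assume nonconst: "\<not> constant_along r I f"
  have "supp_card I f \<noteq> 0" using extremal_nonzero[OF ext fin] fin by (simp add: supp_card_eq_0_iff)
  then have "\<gamma> \<noteq> 0" using supp_card_slices[OF fin r, of f] equal by simp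
  from ext fin r nonconst show False
  proof (cases rule: extremal_cases)
    case (vanishing k)
    obtain l where l: "l < q" "l \<noteq> k" using other_symbol by blast
    have "supp_card (I - {r}) (slice r l f) = 0"
      using vanishes_offD[OF vanishing(2) r l] fin by (simp add: supp_card_eq_0_iff)
    then show False using equal[OF l(1)] \<open>\<gamma> \<noteq> 0\<close> by simp
  next
    case (splitting k i' j')
    obtain l where l: "l < q" "l \<noteq> k" using other_symbol by blast
    have "(q - 1) * \<gamma> = \<gamma>"
      using splits_alongD(2)[OF splitting(4)] splits_alongD(3)[OF splitting(4) l]
        equal splitting(1) l(1)
      by metis
    then show False using \<open>\<gamma> \<noteq> 0\<close> q_ge_3 by simp
  qed
qed

lemma extremal_splits_along_slice:
  assumes ext: "extremal (Suc i) (Suc j) I f" and fin: "finite I" and r: "r \<in> I"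
    and split: "splits_along (min_supp (card (I - {r})) i (Suc j)) r k I f" and l: "l < q" "l \<noteq> k"
  shows "extremal i (Suc j) (I - {r}) (slice r l f)"
proof -
  have "i + Suc j \<le> card (I - {r})"
    using extremalD(1)[OF ext] card_Suc_Diff1[OF fin r] by linarith
  moreover have "spectrum_between i (Suc j) (I - {r}) (slice r l f)"
    using spectrum_between_slice[OF extremalD(2)[OF ext] r l(1)] by simp
  ultimately show ?thesis unfolding extremal_def using splits_alongD(3)[OF split l] by blast
qed

lemma extremal_splits_along_slice_diff:
  assumes ext: "extremal (Suc i) (Suc j) I f" and fin: "finite I" and r: "r \<in> I" "k < q"
    and split: "splits_along (min_supp (card (I - {r})) i (Suc j)) r k I f" and l: "l < q" "l \<noteq> k"
  shows "extremal i j (I - {r}) (\<lambda>x. slice r k f x - slice r l f x)" (is "extremal i j ?J ?g")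
proof -
  have ij: "i + Suc j \<le> card ?J" "i + j \<le> card ?J"
    using extremalD(1)[OF ext] card_Suc_Diff1[OF fin r(1)] by linarith+
  have spec_diff: "spectrum_between i j ?J ?g"
    using spectrum_between_slice_diff[OF extremalD(2)[OF ext] r l(1)] by simp
  have "supp_card ?J (slice r k f) \<noteq> supp_card ?J (slice r l f)"
    using splits_alongD(2,3)[OF split] l q_ge_3 min_supp_pos[of "card ?J" i "Suc j"] by simp
  then have "\<exists>x\<in>cube ?J. ?g x \<noteq> 0"
    using supp_card_cong[of ?J "slice r k f" "slice r l f"] by force
  then have "min_supp (card ?J) i j \<le> supp_card ?J ?g"
    using fin by (intro supp_bounded_belowD[OF finite_imp_supp_bounded_below _ spec_diff] ij) auto
  moreover have "supp_card ?J ?g \<le> q * min_supp (card ?J) i (Suc j)"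
    using supp_card_diff_le[of ?J "slice r k f" "slice r l f"] splits_alongD(2,3)[OF split]
      l fin q_pos
    by (cases q) simp_all
  moreover have "q * min_supp (card ?J) i (Suc j) = min_supp (card ?J) i j"
    using min_supp_Suc_n[OF ij(1)] by (simp add: min_supp_Suc_n_Suc_j)
  ultimately show ?thesis using ij(2) spec_diff by (simp add: extremal_def)
qed

end

subsection \<open>Products of elementary functions\<close>

lemma words_nth_less: "x \<in> words n q \<Longrightarrow> k < n \<Longrightarrow> x ! k < q"
  by (auto simp: words_def subset_iff)

lemma words_0: "words 0 q = {[]}"
  by (auto simp: words_def)

lemma words_Suc: "words (Suc n) q = (\<lambda>(a, x). a # x) ` ({..<q} \<times> words n q)"
  by (auto simp: words_def length_Suc_conv image_iff)

lemma finite_words: "finite (words n q)"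
  unfolding words_def by (rule finite_lists_length_eq) simp

lemma append_in_words_iff: "length x = m \<Longrightarrow> x @ y \<in> words (m + n) q \<longleftrightarrow> x \<in> words m q \<and> y \<in> words n q"
  by (auto simp: words_def)

lemma supp_size_eq_0_iff: "supp_size n q f = 0 \<longleftrightarrow> (\<forall>x\<in>words n q. f x = 0)"
  using finite_words by (auto simp: supp_size_def card_eq_0_iff)

lemma supp_size_a1:
  assumes "k < q" "m < q"
  shows "supp_size 2 q (a1 k m) = 2 * (q - 1)"
proof -
  let ?A = "(\<lambda>y. [k, y]) ` ({..<q} - {m})" and ?B = "(\<lambda>x. [x, m]) ` ({..<q} - {k})"
  have "{x \<in> words 2 q. a1 k m x \<noteq> 0} = ?A \<union> ?B"
    using assms by (auto simp: numeral_2_eq_2 words_Suc words_0 a1_def)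
  moreover have "card (?A \<union> ?B) = card ?A + card ?B"
    by (rule card_Un_disjoint) auto
  moreover have "card ?A = q - 1" "card ?B = q - 1"
    using assms by (simp_all add: card_image inj_on_def)
  ultimately show ?thesis by (simp add: supp_size_def)
qed

lemma supp_size_one: "supp_size 1 q (\<lambda>z. 1) = q"
  by (simp add: supp_size_def words_def card_lists_length_eq)

lemma supp_size_a4:
  assumes "m < q"
  shows "supp_size 1 q (a4 m) = 1"
proof -
  have "{x \<in> words 1 q. a4 m x \<noteq> 0} = {[m]}"
    using assms by (auto simp: words_Suc words_0 a4_def)
  then show ?thesis by (simp add: supp_size_def)
qed

lemma block_prod_append:
  "length x = sum_list (map fst bs) \<Longrightarrow>
     block_prod (bs @ cs) (x @ y) = block_prod bs x * block_prod cs y"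
proof (induction bs arbitrary: x)
  case (Cons b bs)
  obtain m g where b: "b = (m, g)" by fastforce
  have "length (drop m x) = sum_list (map fst bs)" "m \<le> length x" using Cons.prems b by auto
  then show ?case using Cons.IH[of "drop m x"] b by simp
qed simp

lemma supp_size_block_prod:
  "supp_size (sum_list (map fst bs)) q (block_prod bs) = (\<Prod>(m, g)\<leftarrow>bs. supp_size m q g)"
proof (induction bs)
  case Nil
  then show ?case by (simp add: supp_size_def words_0)
next
  case (Cons b bs)
  obtain m g where b: "b = (m, g)" by fastforce
  let ?n = "sum_list (map fst bs)"
  let ?A = "{x \<in> words m q. g x \<noteq> 0}" and ?B = "{y \<in> words ?n q. block_prod bs y \<noteq> 0}"
  have inj: "inj_on (\<lambda>(x, y). x @ y) (?A \<times> ?B)"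
    by (auto simp: inj_on_def words_def)
  have "{x \<in> words (m + ?n) q. block_prod (b # bs) x \<noteq> 0} = (\<lambda>(x, y). x @ y) ` (?A \<times> ?B)"
  proof (intro set_eqI iffI)
    fix x assume x: "x \<in> {x \<in> words (m + ?n) q. block_prod (b # bs) x \<noteq> 0}"
    then have "length (take m x) = m" by (auto simp: words_def)
    then have "(take m x, drop m x) \<in> ?A \<times> ?B"
      using x append_in_words_iff[of "take m x" m "drop m x" ?n q] by (auto simp: b)
    then show "x \<in> (\<lambda>(x, y). x @ y) ` (?A \<times> ?B)"
      by (intro image_eqI[of _ _ "(take m x, drop m x)"]) simp_all
  qed (auto simp: words_def b)
  then show ?case
    using Cons.IH by (simp add: supp_size_def b card_image[OF inj] card_cartesian_product)
qed

definition F1_blocks :: "nat \<Rightarrow> nat \<Rightarrow> nat \<Rightarrow> nat \<Rightarrow> (nat \<times> (nat list \<Rightarrow> real)) list set" where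
  "F1_blocks q i l p = {map (Pair 2) gs @ map (Pair 1) hs @ map (Pair 1) vs | gs hs vs.
     length gs = i \<and> set gs \<subseteq> A1 q \<and> length hs = l \<and> set hs \<subseteq> A3 \<and> length vs = p \<and> set vs \<subseteq> A4 q}"

lemma F1_blocksE:
  assumes "bs \<in> F1_blocks q i l p"
  obtains gs hs vs where "bs = map (Pair 2) gs @ map (Pair 1) hs @ map (Pair 1) vs"
    "length gs = i" "set gs \<subseteq> A1 q" "length hs = l" "set hs \<subseteq> A3" "length vs = p" "set vs \<subseteq> A4 q"
  using assms unfolding F1_blocks_def by blast

lemma F1_iff_F1_blocks:
  "f \<in> F1 n q i j \<longleftrightarrow>
     (\<exists>c. \<exists>bs\<in>F1_blocks q i (n - i - j) (j - i). \<forall>x\<in>words n q. f x = c * block_prod bs x)"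
  unfolding F1_def F1_blocks_def by blast

lemma F1_blocks_sum_list: "bs \<in> F1_blocks q i l p \<Longrightarrow> sum_list (map fst bs) = 2 * i + l + p"
  by (elim F1_blocksE) (simp add: comp_def sum_list_triv)

lemma F1_blocks_replicate_one: "replicate l (1, \<lambda>z. 1) \<in> F1_blocks q 0 l 0"
  unfolding F1_blocks_def
  by (rule CollectI, rule exI[of _ "[]"], rule exI[of _ "replicate l (\<lambda>z. 1)"], rule exI[of _ "[]"])
     (auto simp: A3_def)

lemma block_prod_replicate_one: "block_prod (replicate l (1, \<lambda>z. 1)) x = 1"
  by (induction l arbitrary: x) simp_all

lemma F1_blocks_Cons_a1:
  assumes "bs \<in> F1_blocks q i l p" "k < q" "m < q"
  shows "(2, a1 k m) # bs \<in> F1_blocks q (Suc i) l p"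
proof -
  obtain gs hs vs where bs: "bs = map (Pair 2) gs @ map (Pair 1) hs @ map (Pair 1) vs"
    and parts: "length gs = i" "set gs \<subseteq> A1 q" "length hs = l" "set hs \<subseteq> A3"
      "length vs = p" "set vs \<subseteq> A4 q"
    using assms(1) by (rule F1_blocksE)
  have "set (a1 k m # gs) \<subseteq> A1 q" using parts(2) assms(2,3) by (auto simp: A1_def)
  then show ?thesis
    unfolding F1_blocks_def bs using parts
    by (intro CollectI exI[of _ "a1 k m # gs"] exI[of _ hs] exI[of _ vs]) simp
qed

lemma F1_blocks_snoc_a4:
  assumes "bs \<in> F1_blocks q i l p" "m < q"
  shows "bs @ [(1, a4 m)] \<in> F1_blocks q i l (Suc p)"
proof -
  obtain gs hs vs where bs: "bs = map (Pair 2) gs @ map (Pair 1) hs @ map (Pair 1) vs"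
    and parts: "length gs = i" "set gs \<subseteq> A1 q" "length hs = l" "set hs \<subseteq> A3"
      "length vs = p" "set vs \<subseteq> A4 q"
    using assms(1) by (rule F1_blocksE)
  have "set (vs @ [a4 m]) \<subseteq> A4 q" using parts(6) assms(2) by (auto simp: A4_def)
  then show ?thesis
    unfolding F1_blocks_def bs using parts
    by (intro CollectI exI[of _ gs] exI[of _ hs] exI[of _ "vs @ [a4 m]"]) simp
qed

lemma F1_blocks_SucE:
  assumes "bs \<in> F1_blocks q i l (Suc p)"
  obtains bs' m where "bs = bs' @ [(1, a4 m)]" "m < q"
proof -
  obtain gs hs vs where bs: "bs = map (Pair 2) gs @ map (Pair 1) hs @ map (Pair 1) vs"
    and vs: "length vs = Suc p" "set vs \<subseteq> A4 q"
    using assms by (rule F1_blocksE)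
  obtain vs' v where "vs = vs' @ [v]" using vs(1) by (metis length_Suc_conv_rev)
  then show thesis using that bs vs(2) by (auto simp: A4_def)
qed

lemma prod_list_map_const:
  fixes c :: "'a :: monoid_mult"
  shows "(\<And>x. x \<in> set xs \<Longrightarrow> f x = c) \<Longrightarrow> prod_list (map f xs) = c ^ length xs"
  by (induction xs) auto

lemma supp_size_F1_blocks:
  assumes "bs \<in> F1_blocks q i l p"
  shows "supp_size (2 * i + l + p) q (block_prod bs) = (2 * (q - 1)) ^ i * q ^ l"
proof -
  obtain gs hs vs where bs: "bs = map (Pair 2) gs @ map (Pair 1) hs @ map (Pair 1) vs"
    and gs: "length gs = i" "set gs \<subseteq> A1 q" and hs: "length hs = l" "set hs \<subseteq> A3"
    and vs: "length vs = p" "set vs \<subseteq> A4 q"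
    using assms by (rule F1_blocksE)
  have "prod_list (map (supp_size 2 q) gs) = (2 * (q - 1)) ^ i"
    using gs prod_list_map_const[of gs "supp_size 2 q" "2 * (q - 1)"] supp_size_a1
    by (auto simp: A1_def)
  moreover have "prod_list (map (supp_size 1 q) hs) = q ^ l"
    using hs prod_list_map_const[of hs "supp_size 1 q" q] supp_size_one by (auto simp: A3_def)
  moreover have "prod_list (map (supp_size 1 q) vs) = 1"
    using vs prod_list_map_const[of vs "supp_size 1 q" 1] supp_size_a4 by (auto simp: A4_def)
  ultimately show ?thesis
    using supp_size_block_prod[of bs q] F1_blocks_sum_list[OF assms] by (simp add: bs comp_def)
qed

lemma supp_size_F1:
  assumes "f \<in> F1 n q i j" "i \<le> j" "i + j \<le> n" "\<exists>x\<in>words n q. f x \<noteq> 0"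
  shows "supp_size n q f = 2 ^ i * (q - 1) ^ i * q ^ (n - i - j)"
proof -
  obtain c bs where bs: "bs \<in> F1_blocks q i (n - i - j) (j - i)"
    and f: "\<And>x. x \<in> words n q \<Longrightarrow> f x = c * block_prod bs x"
    using assms(1) unfolding F1_iff_F1_blocks by blast
  have "c \<noteq> 0" using assms(4) f by auto
  then have "supp_size n q f = supp_size n q (block_prod bs)"
    unfolding supp_size_def using f by (intro arg_cong[where f = card]) auto
  then show ?thesis
    using supp_size_F1_blocks[OF bs] assms(2,3) by (simp add: power_mult_distrib)
qed

context alphabet
begin

definition elementary_product :: "'a set \<Rightarrow> nat \<Rightarrow> nat \<Rightarrow> nat \<Rightarrow> (('a \<Rightarrow> nat) \<Rightarrow> real) \<Rightarrow> bool" where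
  "elementary_product I i l p f \<longleftrightarrow> (\<exists>rs c. \<exists>bs\<in>F1_blocks q i l p.
     distinct rs \<and> set rs = I \<and> length rs = sum_list (map fst bs) \<and>
     (\<forall>x\<in>cube I. f x = c * block_prod bs (map x rs)))"

lemma elementary_productE:
  assumes "elementary_product I i l p f"
  obtains rs c bs where "bs \<in> F1_blocks q i l p" "distinct rs" "set rs = I"
    "length rs = sum_list (map fst bs)" "\<And>x. x \<in> cube I \<Longrightarrow> f x = c * block_prod bs (map x rs)"
  using assms unfolding elementary_product_def by blast

lemma elementary_product_const:
  assumes "finite I" "\<And>x. x \<in> cube I \<Longrightarrow> f x = c"
  shows "elementary_product I 0 (card I) 0 f"
proof -
  let ?bs = "replicate (card I) (1, \<lambda>z :: nat list. 1 :: real)"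
  obtain rs where "set rs = I" "distinct rs" using finite_distinct_list[OF assms(1)] by blast
  moreover have "length rs = sum_list (map fst ?bs)"
    using distinct_card \<open>set rs = I\<close> \<open>distinct rs\<close> by (fastforce simp: sum_list_replicate)
  moreover have "f x = c * block_prod ?bs (map x rs)" if "x \<in> cube I" for x
    using assms(2)[OF that] by (simp only: block_prod_replicate_one mult_1_right)
  ultimately show ?thesis
    unfolding elementary_product_def using F1_blocks_replicate_one by blast
qed

lemma elementary_product_indicator:
  assumes prod: "elementary_product (I - {r}) i l p (slice r k f)"
    and r: "r \<in> I" "k < q" "vanishes_off r k I f"
  shows "elementary_product I i l (Suc p) f"
proof -
  obtain rs c bs where bs: "bs \<in> F1_blocks q i l p" and rs: "distinct rs" "set rs = I - {r}"
    and len: "length rs = sum_list (map fst bs)"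
    and slice: "\<And>x. x \<in> cube (I - {r}) \<Longrightarrow> slice r k f x = c * block_prod bs (map x rs)"
    using prod by (rule elementary_productE) blast
  have "f x = c * block_prod (bs @ [(1, a4 k)]) (map x (rs @ [r]))" if x: "x \<in> cube I" for x
  proof (cases "x r = k")
    case True
    have "map (x(r := undefined)) rs = map x rs" using rs(2) by auto
    moreover have "slice r k f (x(r := undefined)) = f x"
      using True by (auto simp: slice_def fun_upd_idem)
    ultimately have "f x = c * block_prod bs (map x rs)"
      using slice[OF undefined_upd_in_cube_Diff[OF x]] by (simp only:)
    then show ?thesis using True len by (simp add: block_prod_append a4_def)
  next
    case False
    then have "f x = 0" using r(3) x by (simp add: vanishes_off_def)
    then show ?thesis using False len by (simp add: block_prod_append a4_def)
  qed
  moreover have "distinct (rs @ [r])" "set (rs @ [r]) = I" using rs r(1) by auto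
  moreover have "length (rs @ [r]) = sum_list (map fst (bs @ [(1, a4 k)]))" using len by simp
  ultimately show ?thesis
    unfolding elementary_product_def using F1_blocks_snoc_a4[OF bs r(2)] by blast
qed

lemma elementary_product_a1:
  assumes prod: "elementary_product (I - {r} - {s}) i l p u"
    and rs: "r \<in> I" "s \<in> I" "r \<noteq> s" and km: "k < q" "m < q"
    and f: "\<And>x a b. x \<in> cube (I - {r} - {s}) \<Longrightarrow> a < q \<Longrightarrow> b < q \<Longrightarrow>
      f (x(r := a, s := b)) = a1 k m [a, b] * u x"
  shows "elementary_product I (Suc i) l p f"
proof -
  obtain ts c bs where bs: "bs \<in> F1_blocks q i l p" and ts: "distinct ts" "set ts = I - {r} - {s}"
    and len: "length ts = sum_list (map fst bs)"
    and u: "\<And>x. x \<in> cube (I - {r} - {s}) \<Longrightarrow> u x = c * block_prod bs (map x ts)"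
    using prod by (rule elementary_productE) blast
  have "f x = c * block_prod ((2, a1 k m) # bs) (map x (r # s # ts))" if x: "x \<in> cube I" for x
  proof -
    let ?z = "x(r := undefined, s := undefined)"
    have z: "?z \<in> cube (I - {r} - {s})" using x by (intro undefined_upd_in_cube_Diff)
    have "map ?z ts = map x ts" using ts(2) by auto
    moreover have "?z(r := x r, s := x s) = x" by auto
    ultimately have "f x = a1 k m [x r, x s] * (c * block_prod bs (map x ts))"
      using f[OF z, of "x r" "x s"] u[OF z] rs cube_less[OF x] by (simp only:)
    then show ?thesis by (simp add: numeral_2_eq_2)
  qed
  moreover have "distinct (r # s # ts)" "set (r # s # ts) = I" using ts rs by auto
  moreover have "length (r # s # ts) = sum_list (map fst ((2, a1 k m) # bs))" using len by simp
  ultimately show ?thesis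
    unfolding elementary_product_def using F1_blocks_Cons_a1[OF bs km] by blast
qed

lemma elementary_product_vanishes_off:
  assumes "elementary_product I i l (Suc p) f"
  obtains r k where "r \<in> I" "k < q" "vanishes_off r k I f"
proof -
  obtain rs c bs where bs: "bs \<in> F1_blocks q i l (Suc p)" and rs: "set rs = I"
    and len: "length rs = sum_list (map fst bs)"
    and f: "\<And>x. x \<in> cube I \<Longrightarrow> f x = c * block_prod bs (map x rs)"
    using assms by (rule elementary_productE) blast
  obtain bs' k where bs': "bs = bs' @ [(1, a4 k)]" and k: "k < q"
    using bs by (rule F1_blocks_SucE)
  obtain rs' r where rs': "rs = rs' @ [r]"
    using len bs' by (cases rs rule: rev_cases) auto
  have "f x = 0" if "x \<in> cube I" "x r \<noteq> k" for x
    using f[OF that(1)] that(2) len by (simp add: bs' rs' block_prod_append a4_def)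
  then have "vanishes_off r k I f" by (simp add: vanishes_off_def)
  moreover have "r \<in> I" using rs rs' by auto
  ultimately show thesis using k that by blast
qed

end

subsection \<open>The case of equality\<close>

context large_alphabet
begin

definition vanishes_off_cross ::
  "'a \<Rightarrow> nat \<Rightarrow> 'a \<Rightarrow> nat \<Rightarrow> 'a set \<Rightarrow> (('a \<Rightarrow> nat) \<Rightarrow> 'c :: zero) \<Rightarrow> bool" where
  "vanishes_off_cross r k y m I f \<longleftrightarrow> (\<forall>x\<in>cube I. x r \<noteq> k \<longrightarrow> x y \<noteq> m \<longrightarrow> f x = 0)"

lemma vanishes_off_crossD:
  "vanishes_off_cross r k y m I f \<Longrightarrow> x \<in> cube I \<Longrightarrow> x r \<noteq> k \<Longrightarrow> x y \<noteq> m \<Longrightarrow> f x = 0"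
  unfolding vanishes_off_cross_def by blast

lemma vanishes_off_cross_commute: "vanishes_off_cross r k y m I f \<longleftrightarrow> vanishes_off_cross y m r k I f"
  unfolding vanishes_off_cross_def by blast

lemma splits_along_vanishes_off_cross:
  assumes split: "splits_along \<beta> r k I f" and l: "l < q" "l \<noteq> k" and r: "r \<in> I" "y \<noteq> r"
    and vanish: "vanishes_off y m (I - {r}) (slice r l f)"
  shows "vanishes_off_cross r k y m I f"
  unfolding vanishes_off_cross_def
proof (intro ballI impI)
  fix x assume x: "x \<in> cube I" "x r \<noteq> k" "x y \<noteq> m"
  let ?z = "x(r := undefined)"
  have z: "?z \<in> cube (I - {r})" by (rule undefined_upd_in_cube_Diff[OF x(1)])
  have "f x = slice r (x r) f ?z" by (simp add: slice_def)
  also have "\<dots> = slice r l f ?z"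
    using splits_alongD(1)[OF split]
    by (rule slices_agreeD) (use x(2) cube_less[OF x(1) r(1)] l z in auto)
  also have "\<dots> = 0" using vanish z x(3) r(2) by (simp add: vanishes_off_def)
  finally show "f x = 0" .
qed

lemma supp_card_cross_arm:
  assumes fin: "finite I" and ry: "r \<in> I" "y \<in> I" "r \<noteq> y" and a: "a < q" "a \<noteq> k" and "m < q"
    and split: "splits_along \<beta> r k I f"
    and zero: "vanishes_off_cross r k y m I f"
  shows "supp_card (I - {r} - {y}) (slice y m (slice r a f)) = \<beta>"
proof -
  have "slice r a f z = 0" if "z \<in> cube (I - {r})" "z y \<noteq> m" for z
    using vanishes_off_crossD[OF zero, of "z(r := a)"] fun_upd_in_cube[of z I r a] that ry a
    by (simp add: slice_def)
  then have "vanishes_off y m (I - {r}) (slice r a f)" by (simp add: vanishes_off_def)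
  then show ?thesis
    using supp_card_vanishes_off[of "I - {r}" y m "slice r a f"] splits_alongD(3)[OF split a]
      fin ry \<open>m < q\<close>
    by simp
qed

lemma splits_along_index_eq:
  assumes split: "splits_along \<beta> y k I f" and "y \<in> I" and x: "x \<in> cube I" "f x \<noteq> 0"
    and zero: "\<And>b. b < q \<Longrightarrow> b \<noteq> x y \<Longrightarrow> f (x(y := b)) = 0"
  shows "k = x y"
proof (rule ccontr)
  assume "k \<noteq> x y"
  obtain b where b: "b < q" "b \<noteq> x y" "b \<noteq> k" using other_symbol by blast
  have "slice y (x y) f (x(y := undefined)) = slice y b f (x(y := undefined))"
    using splits_alongD(1)[OF split]
    by (rule slices_agreeD)
       (use b \<open>k \<noteq> x y\<close> cube_less[OF x(1) \<open>y \<in> I\<close>] undefined_upd_in_cube_Diff[OF x(1)] in auto)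
  then show False using zero[OF b(1,2)] x(2) by (simp add: slice_def)
qed

end

locale cross = large_alphabet +
  fixes I :: "'a set" and r y :: 'a and k m \<beta> :: nat and f :: "('a \<Rightarrow> nat) \<Rightarrow> real"
  assumes fin: "finite I" and ry: "r \<in> I" "y \<in> I" "r \<noteq> y" and km: "k < q" "m < q"
    and split: "splits_along \<beta> r k I f" "splits_along \<beta> y m I f"
    and zero: "vanishes_off_cross r k y m I f"
begin

lemma supp_card_cross:
  assumes ab: "a < q" "b < q"
  shows "supp_card (I - {r} - {y}) (slice y b (slice r a f)) = (if a = k \<longleftrightarrow> b = m then 0 else \<beta>)"
proof -
  let ?K = "I - {r} - {y}"
  have K: "I - {y} - {r} = ?K" by auto
  have swap: "slice y b (slice r a f) = slice r a (slice y b f)" for a b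
    using ry(3) by (simp add: slice_commute)
  have arm_y: "supp_card ?K (slice y m (slice r a f)) = \<beta>" if "a < q" "a \<noteq> k" for a
    by (rule supp_card_cross_arm[OF fin ry that km(2) split(1) zero])
  have arm_r: "supp_card ?K (slice y b (slice r k f)) = \<beta>" if "b < q" "b \<noteq> m" for b
    using supp_card_cross_arm[OF fin ry(2,1) ry(3)[symmetric] that km(1) split(2)] zero
    by (simp add: K swap vanishes_off_cross_commute[of r])
  have corner: "supp_card ?K (slice y m (slice r k f)) = 0"
  proof -
    have "(q - 1) * \<beta> = supp_card (I - {y}) (slice y m f)"
      using splits_alongD(2)[OF split(2)] by simp
    also have "\<dots> = supp_card ?K (slice y m (slice r k f)) +
        (\<Sum>a\<in>{..<q} - {k}. supp_card ?K (slice y m (slice r a f)))"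
      unfolding swap K[symmetric] using fin ry km(1) by (intro supp_card_slices_remove) auto
    also have "(\<Sum>a\<in>{..<q} - {k}. supp_card ?K (slice y m (slice r a f))) = (q - 1) * \<beta>"
      using km(1) by (simp add: arm_y)
    finally show ?thesis by simp
  qed
  have off: "supp_card ?K (slice y b (slice r a f)) = 0" if "a \<noteq> k" "b \<noteq> m"
  proof -
    have "slice y b (slice r a f) z = 0" if "z \<in> cube ?K" for z
    proof -
      have "z(y := b) \<in> cube (I - {r})" using that ry ab by (intro fun_upd_in_cube) auto
      then have "z(y := b, r := a) \<in> cube I" using ry ab by (intro fun_upd_in_cube) auto
      then show ?thesis
        using vanishes_off_crossD[OF zero] \<open>a \<noteq> k\<close> \<open>b \<noteq> m\<close> ry(3) by (simp add: slice_def)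
    qed
    then show ?thesis using fin by (simp add: supp_card_eq_0_iff)
  qed
  show ?thesis using arm_y arm_r corner off ab by auto
qed

lemma slice_slice_eq_0:
  assumes "a < q" "b < q" "a = k \<longleftrightarrow> b = m" "z \<in> cube (I - {r} - {y})"
  shows "slice y b (slice r a f) z = 0"
  using supp_card_cross[OF assms(1,2)] assms(3,4) fin by (simp add: supp_card_eq_0_iff)

lemma supp_card_slice_diff:
  assumes l: "l < q" "l \<noteq> k" and b: "b < q"
  shows "supp_card (I - {r} - {y}) (slice y b (\<lambda>x. slice r k f x - slice r l f x)) = \<beta>"
proof -
  let ?K = "I - {r} - {y}" and ?g = "\<lambda>x. slice r k f x - slice r l f x"
  have slice_g: "slice y b ?g z = slice y b (slice r k f) z - slice y b (slice r l f) z" for b z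
    by (simp add: slice_def)
  show ?thesis
  proof (cases "b = m")
    case True
    then have "supp_card ?K (slice y b ?g) = supp_card ?K (slice y b (slice r l f))"
      using slice_slice_eq_0[OF km(1) b] by (intro supp_card_cong) (simp add: slice_g)
    then show ?thesis using supp_card_cross[OF l(1) b] True l by simp
  next
    case False
    then have "supp_card ?K (slice y b ?g) = supp_card ?K (slice y b (slice r k f))"
      using slice_slice_eq_0[OF l(1) b] l by (intro supp_card_cong) (simp add: slice_g)
    then show ?thesis using supp_card_cross[OF km(1) b] False by simp
  qed
qed

lemma eq_a1_mult_slice_diff:
  assumes l: "l < q" "l \<noteq> k"
    and const: "constant_along y (I - {r}) (\<lambda>x. slice r k f x - slice r l f x)"
    and z: "z \<in> cube (I - {r} - {y})" and ab: "a < q" "b < q"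
  shows "f (z(r := a, y := b)) = a1 k m [a, b] * slice y m (\<lambda>x. slice r k f x - slice r l f x) z"
    (is "_ = _ * ?u")
proof -
  have diff: "slice y c (slice r k f) z - slice y c (slice r l f) z = ?u" if "c < q" for c
    using slices_agreeD[OF const, of c m z] that km(2) z by (simp add: slice_def)
  have "f (z(r := a, y := b)) = slice y b (slice r a f) z"
    using ry(3) by (simp add: slice_def fun_upd_twist)
  also have "\<dots> = a1 k m [a, b] * ?u"
  proof -
    consider (off) "a = k \<longleftrightarrow> b = m" | (row) "a = k" "b \<noteq> m" | (column) "a \<noteq> k" "b = m" by blast
    then show ?thesis
    proof cases
      case off
      then show ?thesis using slice_slice_eq_0[OF ab off z] by (auto simp: a1_def)
    next
      case row
      then show ?thesis
        using diff[OF ab(2)] slice_slice_eq_0[OF l(1) ab(2) _ z] l(2) by (simp add: a1_def)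
    next
      case column
      have "z(y := m) \<in> cube (I - {r})" using z ry km(2) by (intro fun_upd_in_cube) auto
      then have "slice y m (slice r a f) z = slice y m (slice r l f) z"
        using slices_agreeD[OF splits_alongD(1)[OF split(1)], of a l "z(y := m)"] column(1) ab(1) l
        by (simp add: slice_def)
      then show ?thesis
        using diff[OF km(2)] slice_slice_eq_0[OF km _ z] column by (simp add: a1_def)
    qed
  qed
  finally show ?thesis .
qed

lemma extremal_eq_a1_mult:
  assumes ext: "extremal (Suc i) (Suc j) I f" and \<beta>: "\<beta> = min_supp (card (I - {r})) i (Suc j)"
  obtains u where "extremal i j (I - {r} - {y}) u"
    "\<And>z a b. z \<in> cube (I - {r} - {y}) \<Longrightarrow> a < q \<Longrightarrow> b < q \<Longrightarrow>
       f (z(r := a, y := b)) = a1 k m [a, b] * u z"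
proof -
  obtain l where l: "l < q" "l \<noteq> k" using other_symbol by blast
  let ?g = "\<lambda>x. slice r k f x - slice r l f x"
  have ext_g: "extremal i j (I - {r}) ?g"
    using split(1) unfolding \<beta>
    by (rule extremal_splits_along_slice_diff[OF ext fin ry(1) km(1) _ l])
  have const: "constant_along y (I - {r}) ?g"
    by (rule extremal_equal_slices_imp_constant_along[OF ext_g _ _ supp_card_slice_diff[OF l]])
       (use fin ry in simp_all)
  have "i + j < card (I - {r})"
    using extremalD(1)[OF ext] card_Suc_Diff1[OF fin ry(1)] by linarith
  then have "extremal i j (I - {r} - {y}) (slice y m ?g)"
    using fin ry km(2) by (intro extremal_constant_along[OF ext_g _ _ _ const]) auto
  then show thesis using that eq_a1_mult_slice_diff[OF l const] by blast
qed

end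

context large_alphabet
begin

lemma extremal_cross_cases:
  assumes ext: "extremal (Suc i) (Suc j) I f" and fin: "finite I"
    and ry: "r \<in> I" "y \<in> I" "r \<noteq> y" and km: "k < q" "m < q"
    and split: "splits_along (min_supp (card (I - {r})) i (Suc j)) r k I f"
    and zero: "vanishes_off_cross r k y m I f"
  obtains (vanishing) b where "b < q" "vanishes_off y b I f"
    | (cross) u where "extremal i j (I - {r} - {y}) u"
      "\<And>z a b. z \<in> cube (I - {r} - {y}) \<Longrightarrow> a < q \<Longrightarrow> b < q \<Longrightarrow>
         f (z(r := a, y := b)) = a1 k m [a, b] * u z"
proof -
  obtain l where l: "l < q" "l \<noteq> k" using other_symbol by blast
  obtain z where z: "z \<in> cube (I - {r})" "slice r l f z \<noteq> 0"
    using extremal_nonzero[OF extremal_splits_along_slice[OF ext fin ry(1) split l]] fin by auto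
  have "z(r := l) \<in> cube I" using z(1) ry(1) l(1) by (intro fun_upd_in_cube) auto
  then obtain x where x: "x \<in> cube I" "x r \<noteq> k" "f x \<noteq> 0"
    using that[of "z(r := l)"] z(2) l(2) by (simp add: slice_def)
  have xy: "x y = m" using vanishes_off_crossD[OF zero x(1,2)] x(3) by blast
  have zero_x: "f (x(y := b)) = 0" if "b < q" "b \<noteq> x y" for b
    using vanishes_off_crossD[OF zero, of "x(y := b)"] fun_upd_in_cube[of x I y b]
      x that ry xy by simp
  have nonconst: "\<not> constant_along y I f"
  proof
    assume const: "constant_along y I f"
    obtain b where b: "b < q" "b \<noteq> x y" using other_symbol by blast
    then show False using constant_along_fun_upd[OF const ry(2) x(1)] zero_x[OF b] x(3) by simp
  qed
  from ext fin ry(2) nonconst show thesis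
  proof (cases rule: extremal_cases)
    case (vanishing b)
    then show thesis by (rule that(1))
  next
    case (splitting k' i' j')
    have "k' = m"
      using splits_along_index_eq[OF splitting(4) ry(2) x(1,3) zero_x] xy by simp
    then have "splits_along (min_supp (card (I - {r})) i (Suc j)) y m I f"
      using splitting(2,4) fin ry(1,2) by simp
    then interpret cross q I r y k m "min_supp (card (I - {r})) i (Suc j)" f
      using fin ry km split zero by unfold_locales
    show thesis using extremal_eq_a1_mult[OF ext refl] cross by blast
  qed
qed

lemma elementary_product_if_vanishes_off:
  assumes IH: "\<And>K i j g. K \<subset> I \<Longrightarrow> extremal i j K g \<Longrightarrow>
      elementary_product K i (card K - i - j) (j - i) g"
    and ext: "extremal i j I f" and fin: "finite I" and r: "r \<in> I" "k < q" "vanishes_off r k I f"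
  shows "elementary_product I i (card I - i - j) (j - i) f"
proof -
  obtain j' where j': "j = Suc j'" and ext': "extremal i j' (I - {r}) (slice r k f)"
    using extremal_vanishes_off[OF ext fin r] .
  have "i \<le> j'"
    using spectrum_between_imp_le[OF extremalD(2)[OF ext']] extremal_nonzero[OF ext'] fin by simp
  then have "card I - i - j = card (I - {r}) - i - j'" "j - i = Suc (j' - i)"
    using card_Suc_Diff1[OF fin r(1)] j' by linarith+
  moreover have "I - {r} \<subset> I" using r(1) by auto
  ultimately show ?thesis using elementary_product_indicator[OF IH[OF _ ext'] r] by simp
qed

lemma elementary_product_if_constant_along_all:
  assumes ext: "extremal i j I f" and fin: "finite I" and const: "\<And>r. r \<in> I \<Longrightarrow> constant_along r I f"
  shows "elementary_product I i (card I - i - j) (j - i) f"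
proof -
  obtain x where x: "x \<in> cube I" using extremal_nonzero[OF ext fin] by blast
  have "i = 0"
    by (rule spectrum_between_constant_along_all_imp_0[OF extremalD(2)[OF ext] fin const])
       (use extremal_nonzero[OF ext fin] in simp_all)
  have "supp_card I f = q ^ card I"
    by (rule supp_card_constant_along_all[OF fin const])
       (use extremal_nonzero[OF ext fin] in simp_all)
  then have "q ^ card I = q ^ (card I - j)"
    using extremalD(3)[OF ext] by (simp add: \<open>i = 0\<close> min_supp_def)
  then have "j = 0"
    using q_ge_3 extremalD(1)[OF ext] by (simp add: \<open>i = 0\<close>)
  moreover have "f y = f x" if "y \<in> cube I" for y
    using fin const that x by (rule constant_along_all_imp_eq)
  ultimately show ?thesis
    using elementary_product_const[OF fin, of f "f x"] by (simp add: \<open>i = 0\<close>)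
qed

lemma elementary_product_if_splits_along:
  assumes IH: "\<And>K i j g. K \<subset> I \<Longrightarrow> extremal i j K g \<Longrightarrow>
      elementary_product K i (card K - i - j) (j - i) g"
    and ext: "extremal (Suc i) (Suc j) I f" and fin: "finite I" and r: "r \<in> I" "k < q"
    and split: "splits_along (min_supp (card (I - {r})) i (Suc j)) r k I f"
  shows "elementary_product I (Suc i) (card I - Suc i - Suc j) (j - i) f"
proof -
  let ?J = "I - {r}"
  have "i \<le> j"
    using spectrum_between_imp_le[OF extremalD(2)[OF ext] fin extremal_nonzero[OF ext fin]] by simp
  obtain l where l: "l < q" "l \<noteq> k" using other_symbol by blast
  have "?J \<subset> I" using r(1) by auto
  then have "elementary_product ?J i (card ?J - i - Suc j) (Suc (j - i)) (slice r l f)"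
    using IH[OF _ extremal_splits_along_slice[OF ext fin r(1) split l]] \<open>i \<le> j\<close>
    by (simp add: Suc_diff_le)
  then obtain y m where y: "y \<in> ?J" "m < q" "vanishes_off y m ?J (slice r l f)"
    by (rule elementary_product_vanishes_off)
  have ry: "r \<in> I" "y \<in> I" "r \<noteq> y" using r(1) y(1) by auto
  let ?K = "?J - {y}"
  have K: "card I = Suc (Suc (card ?K))" "?K \<subset> I"
    using card_Suc_Diff1[OF fin ry(1)] card_Suc_Diff1[of ?J y] fin y(1) r(1) by auto
  have "vanishes_off_cross r k y m I f"
    by (rule splits_along_vanishes_off_cross[OF split l ry(1) ry(3)[symmetric] y(3)])
  with ext fin ry r(2) y(2) split show ?thesis
  proof (cases rule: extremal_cross_cases)
    case (vanishing b)
    have "elementary_product I (Suc i) (card I - Suc i - Suc j) (Suc j - Suc i) f"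
      by (rule elementary_product_if_vanishes_off[OF IH ext fin ry(2) vanishing])
    then show ?thesis by simp
  next
    case (cross u)
    have "elementary_product ?K i (card ?K - i - j) (j - i) u"
      using K(2) cross(1) by (rule IH)
    then have "elementary_product I (Suc i) (card ?K - i - j) (j - i) f"
      using ry r(2) y(2) cross(2) by (rule elementary_product_a1)
    then show ?thesis by (simp add: K(1))
  qed
qed

theorem extremal_imp_elementary_product:
  "finite I \<Longrightarrow> extremal i j I f \<Longrightarrow> elementary_product I i (card I - i - j) (j - i) f"
proof (induction I arbitrary: i j f rule: finite_psubset_induct)
  case (psubset I)
  note fin = psubset.hyps and ext = psubset.prems
  show ?case
  proof (cases "\<forall>r\<in>I. constant_along r I f")
    case True
    then show ?thesis using elementary_product_if_constant_along_all[OF ext fin] by blast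
  next
    case False
    then obtain r where r: "r \<in> I" "\<not> constant_along r I f" by blast
    from ext fin r show ?thesis
    proof (cases rule: extremal_cases)
      case (vanishing k)
      show ?thesis
        by (rule elementary_product_if_vanishes_off[OF psubset.IH ext fin r(1) vanishing])
    next
      case (splitting k i' j')
      have "elementary_product I (Suc i') (card I - Suc i' - Suc j') (j' - i') f"
        by (rule elementary_product_if_splits_along[OF psubset.IH _ fin r(1) splitting(1)])
           (use ext splitting in simp_all)
      then show ?thesis by (simp add: splitting(2,3))
    qed
  qed
qed

end

subsection \<open>Words as lists\<close>

lemma hamming_neighbours:
  assumes w: "w \<in> words n q"
  shows "{y \<in> words n q. hamming_adj n w y} =
    (\<lambda>(r, k). w[r := k]) ` (SIGMA r:{..<n}. {..<q} - {w ! r})" (is "?N = ?u ` ?S")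
proof (intro set_eqI iffI)
  have len: "length w = n" using w by (simp add: words_def)
  fix y assume "y \<in> ?N"
  then have y: "y \<in> words n q" "card {k. k < n \<and> w ! k \<noteq> y ! k} = 1" by (auto simp: hamming_adj_def)
  then obtain r where differ: "{k. k < n \<and> w ! k \<noteq> y ! k} = {r}"
    by (auto simp: card_1_singleton_iff)
  then have r: "r < n" "w ! r \<noteq> y ! r" by auto
  have agree: "w ! l = y ! l" if "l < n" "l \<noteq> r" for l using differ that by blast
  have "length y = n" using y(1) by (simp add: words_def)
  then have "y = w[r := y ! r]"
    using len r(1) by (intro nth_equalityI) (simp_all add: nth_list_update agree)
  moreover have "(r, y ! r) \<in> ?S" using r words_nth_less[OF y(1)] by auto
  ultimately show "y \<in> ?u ` ?S" by (intro image_eqI[of _ _ "(r, y ! r)"]) simp_all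
next
  have len: "length w = n" using w by (simp add: words_def)
  fix y assume "y \<in> ?u ` ?S"
  then obtain r k where y: "r < n" "k < q" "k \<noteq> w ! r" "y = w[r := k]" by auto
  have "set y \<subseteq> {..<q}" using set_update_subset_insert[of w r k] w y by (auto simp: words_def)
  moreover have "{l. l < n \<and> w ! l \<noteq> y ! l} = {r}" using y len by (auto simp: nth_list_update)
  ultimately show "y \<in> ?N" using len y by (simp add: words_def hamming_adj_def)
qed

lemma inj_on_list_update: "inj_on (\<lambda>(r, k). w[r := k]) (SIGMA r:{..<length w}. A - {w ! r})"
  (is "inj_on ?u ?S")
proof (rule inj_onI)
  fix p p' assume "p \<in> ?S" "p' \<in> ?S" and same: "?u p = ?u p'"
  then obtain r k r' k' where p: "p = (r, k)" "p' = (r', k')"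
    and r: "r < length w" "k \<noteq> w ! r" "r' < length w" "k' \<noteq> w ! r'" by auto
  have eq: "w[r := k] = w[r' := k']" using same p by simp
  then have "r = r'" using r by (metis nth_list_update_eq nth_list_update_neq)
  then show "p = p'" using eq p r(1) by (metis nth_list_update_eq)
qed

lemma sum_hamming_neighbours:
  assumes w: "w \<in> words n q"
  shows "(\<Sum>y | y \<in> words n q \<and> hamming_adj n w y. f y) =
    (\<Sum>r<n. \<Sum>k\<in>{..<q} - {w ! r}. f (w[r := k]))"
proof -
  have "length w = n" using w by (simp add: words_def)
  then have "(\<Sum>y | y \<in> words n q \<and> hamming_adj n w y. f y) =
      (\<Sum>(r, k)\<in>(SIGMA r:{..<n}. {..<q} - {w ! r}). f (w[r := k]))"
    using inj_on_list_update[of w "{..<q}"]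
    by (simp add: hamming_neighbours[OF w] sum.reindex split_def)
  then show ?thesis by (simp add: sum.Sigma)
qed

lemma supp_size_permute_fun:
  assumes "\<sigma> permutes {..<n}"
  shows "supp_size n q (permute_fun \<sigma> f) = supp_size n q f"
proof -
  have words: "permute_list \<tau> x \<in> words n q" if "\<tau> permutes {..<n}" "x \<in> words n q" for \<tau> x
    using that by (auto simp: words_def)
  have inverse: "permute_list (inv \<sigma>) (permute_list \<sigma> x) = x"
    "permute_list \<sigma> (permute_list (inv \<sigma>) x) = x"
    if "x \<in> words n q" for x
    using that permute_list_compose[of "inv \<sigma>" x \<sigma>] permute_list_compose[of \<sigma> x "inv \<sigma>"]
      assms permutes_inv[OF assms] permutes_inv_o[OF assms]
    by (auto simp: words_def)
  have "bij_betw (permute_list \<sigma>) (words n q) (words n q)"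
    by (rule bij_betw_byWitness[where f' = "permute_list (inv \<sigma>)"])
       (use inverse words assms permutes_inv[OF assms] in auto)
  then have "bij_betw (permute_list \<sigma>) {x \<in> words n q. permute_fun \<sigma> f x \<noteq> 0}
      {x \<in> words n q. f x \<noteq> 0}"
    by (rule bij_betw_Collect) (simp add: permute_fun_def)
  then show ?thesis by (simp add: supp_size_def bij_betw_same_card)
qed

context alphabet
begin

lemma map_upt_in_words: "x \<in> cube {..<n} \<Longrightarrow> map x [0..<n] \<in> words n q"
  by (auto simp: words_def cube_def PiE_iff)

lemma bij_betw_map_upt: "bij_betw (\<lambda>x. map x [0..<n]) (cube {..<n}) (words n q)"
proof (rule bij_betw_byWitness[where f' = "\<lambda>w. restrict ((!) w) {..<n}"])
  show "\<forall>x\<in>cube {..<n}. restrict ((!) (map x [0..<n])) {..<n} = x"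
    by (auto simp: cube_def fun_eq_iff restrict_def PiE_iff extensional_def)
  show "\<forall>w\<in>words n q. map (restrict ((!) w) {..<n}) [0..<n] = w"
    by (intro ballI nth_equalityI) (auto simp: words_def)
  show "(\<lambda>x. map x [0..<n]) ` cube {..<n} \<subseteq> words n q"
    using map_upt_in_words by blast
  show "(\<lambda>w. restrict ((!) w) {..<n}) ` words n q \<subseteq> cube {..<n}"
    by (intro image_subsetI) (simp add: cube_def restrict_PiE_iff words_nth_less)
qed

lemma supp_card_map_upt: "supp_card {..<n} (\<lambda>x. f (map x [0..<n])) = supp_size n q f"
  unfolding supp_card_def supp_size_def
  by (rule bij_betw_same_card[OF bij_betw_Collect[OF bij_betw_map_upt]]) simp

lemma map_fun_upd_upt: "r < n \<Longrightarrow> map (x(r := k)) [0..<n] = (map x [0..<n])[r := k]"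
  by (rule nth_equalityI) (auto simp: nth_list_update)

lemma cube_eigenfunction_map_upt:
  assumes "g \<in> U t n q"
  shows "cube_eigenfunction {..<n} (real t) (\<lambda>x. g (map x [0..<n]))"
  unfolding cube_eigenfunction_def
proof
  fix x assume x: "x \<in> cube {..<n}"
  let ?w = "map x [0..<n]"
  have w: "?w \<in> words n q" by (rule map_upt_in_words[OF x])
  have inner: "(\<Sum>k<q. slice r k (\<lambda>x. g (map x [0..<n])) x) =
      g ?w + (\<Sum>k\<in>{..<q} - {?w ! r}. g (?w[r := k]))"
    if "r < n" for r
  proof -
    have "(\<Sum>k<q. slice r k (\<lambda>x. g (map x [0..<n])) x) = (\<Sum>k<q. g (?w[r := k]))"
      by (simp only: slice_def map_fun_upd_upt[OF that])
    also have "\<dots> = g (?w[r := ?w ! r]) + (\<Sum>k\<in>{..<q} - {?w ! r}. g (?w[r := k]))"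
      using words_nth_less[OF w that] by (intro sum.remove) auto
    finally show ?thesis by simp
  qed
  have "(\<Sum>r<n. \<Sum>k<q. slice r k (\<lambda>x. g (map x [0..<n])) x) =
      (\<Sum>r<n. g ?w + (\<Sum>k\<in>{..<q} - {?w ! r}. g (?w[r := k])))"
    by (intro sum.cong refl inner) simp
  also have "\<dots> = real n * g ?w + eigval t n q * g ?w"
    using assms w sum_hamming_neighbours[OF w, of g]
    by (simp add: sum.distrib U_def eigenfunction_def)
  also have "\<dots> = real q * (real (card {..<n}) - real t) * g ?w"
    by (simp add: eigval_def algebra_simps)
  finally show "(\<Sum>r<n. \<Sum>k<q. slice r k (\<lambda>x. g (map x [0..<n])) x) =
      real q * (real (card {..<n}) - real t) * g ?w" .
qed

lemma U_range_imp_spectrum_between: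
  assumes "f \<in> U_range i j n q"
  shows "spectrum_between i j {..<n} (\<lambda>x. f (map x [0..<n]))"
proof -
  obtain g where g: "\<And>t. t \<in> {i..j} \<Longrightarrow> g t \<in> U t n q"
    and f: "\<And>x. x \<in> words n q \<Longrightarrow> f x = (\<Sum>t=i..j. g t x)"
    using assms unfolding U_range_def by blast
  have "spectrum_between i j {..<n} (\<lambda>x. \<Sum>t=i..j. g t (map x [0..<n]))"
    by (intro sum_cube_eigenfunctions_spectrum_between cube_eigenfunction_map_upt g) simp_all
  then show ?thesis
    by (rule spectrum_between_cong[THEN iffD1, rotated]) (simp add: f map_upt_in_words)
qed

lemma elementary_product_imp_F1:
  assumes "elementary_product {..<n} i (n - i - j) (j - i) (\<lambda>x. f (map x [0..<n]))"
  shows "\<exists>\<sigma>. \<sigma> permutes {..<n} \<and> permute_fun \<sigma> f \<in> F1 n q i j"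
proof -
  obtain rs c bs where bs: "bs \<in> F1_blocks q i (n - i - j) (j - i)"
    and rs: "distinct rs" "set rs = {..<n}"
    and f: "\<And>x. x \<in> cube {..<n} \<Longrightarrow> f (map x [0..<n]) = c * block_prod bs (map x rs)"
    using assms by (rule elementary_productE) blast
  have "mset rs = mset [0..<n]"
    using set_eq_iff_mset_eq_distinct[of rs "[0..<n]"] rs by (simp add: atLeast0LessThan)
  then obtain \<tau> where \<tau>: "\<tau> permutes {..<n}" "permute_list \<tau> [0..<n] = rs"
    by (rule mset_eq_permutation) simp
  define \<sigma> where "\<sigma> = inv \<tau>"
  have \<sigma>: "\<sigma> permutes {..<n}" unfolding \<sigma>_def by (rule permutes_inv[OF \<tau>(1)])
  have rs_map: "rs = map \<tau> [0..<n]"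
    using \<tau>(2)[symmetric] permutes_in_image[OF \<tau>(1)] by (simp add: permute_list_def)
  have "permute_fun \<sigma> f x = c * block_prod bs x" if x: "x \<in> words n q" for x
  proof -
    let ?y = "restrict (\<lambda>k. x ! \<sigma> k) {..<n}"
    have len: "length x = n" using x by (simp add: words_def)
    have "?y \<in> cube {..<n}"
      using words_nth_less[OF x] permutes_in_image[OF \<sigma>] by (auto simp: cube_def)
    moreover have "map ?y [0..<n] = permute_list \<sigma> x"
      by (simp add: permute_list_def len)
    moreover have "map ?y rs = x"
      using permutes_in_image[OF \<tau>(1)] permutes_inverses(2)[OF \<tau>(1)]
      by (intro nth_equalityI) (simp_all add: rs_map len \<sigma>_def)
    ultimately show ?thesis using f[of ?y] by (simp add: permute_fun_def)
  qed
  then show ?thesis using \<sigma> bs unfolding F1_iff_F1_blocks by blast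
qed

end

lemma (in large_alphabet) F1_imp_supp_size_eq_min_supp:
  assumes "\<sigma> permutes {..<n}" "permute_fun \<sigma> f \<in> F1 n q i j" "i \<le> j" "i + j \<le> n"
    and "\<exists>x\<in>words n q. f x \<noteq> 0"
  shows "supp_size n q f = min_supp n i j"
proof -
  have "supp_size n q (permute_fun \<sigma> f) \<noteq> 0"
    using assms(5) by (simp add: supp_size_permute_fun[OF assms(1)] supp_size_eq_0_iff)
  then have "\<exists>x\<in>words n q. permute_fun \<sigma> f x \<noteq> 0" by (simp add: supp_size_eq_0_iff)
  then show ?thesis
    using supp_size_F1[OF assms(2-4)] supp_size_permute_fun[OF assms(1)] by (simp add: min_supp_def)
qed

theorem theorem1:
  fixes q i j n :: nat and f :: "nat list \<Rightarrow> real"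
  assumes "q \<ge> 3" and "i \<le> j" and "n \<ge> i + j"
    and "f \<in> U_range i j n q"
    and "\<exists>x\<in>words n q. f x \<noteq> 0"
  shows "supp_size n q f \<ge> 2 ^ i * (q - 1) ^ i * q ^ (n - i - j) \<and>
         (supp_size n q f = 2 ^ i * (q - 1) ^ i * q ^ (n - i - j) \<longleftrightarrow>
          (\<exists>\<sigma>. \<sigma> permutes {..<n} \<and> permute_fun \<sigma> f \<in> F1 n q i j))"
proof -
  interpret large_alphabet q using assms(1) by unfold_locales auto
  let ?f = "\<lambda>x. f (map x [0..<n])"
  have spec: "spectrum_between i j {..<n} ?f" by (rule U_range_imp_spectrum_between[OF assms(4)])
  have supp: "supp_card {..<n} ?f = supp_size n q f" by (rule supp_card_map_upt)
  have "\<exists>x\<in>cube {..<n}. ?f x \<noteq> 0"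
    using assms(5) supp supp_card_eq_0_iff[of "{..<n}" ?f] supp_size_eq_0_iff[of n q f] by auto
  then have "min_supp n i j \<le> supp_size n q f"
    using supp_bounded_belowD[OF finite_imp_supp_bounded_below _ spec] assms(3) supp by simp
  moreover have "\<exists>\<sigma>. \<sigma> permutes {..<n} \<and> permute_fun \<sigma> f \<in> F1 n q i j"
    if "supp_size n q f = min_supp n i j"
  proof (rule elementary_product_imp_F1)
    have "extremal i j {..<n} ?f" using assms(3) spec supp that by (simp add: extremal_def)
    then show "elementary_product {..<n} i (n - i - j) (j - i) ?f"
      using extremal_imp_elementary_product[of "{..<n}" i j ?f] by simp
  qed
  moreover have "supp_size n q f = min_supp n i j"
    if "\<sigma> permutes {..<n}" "permute_fun \<sigma> f \<in> F1 n q i j" for \<sigma>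
    using F1_imp_supp_size_eq_min_supp[OF that assms(2,3,5)] .
  ultimately show ?thesis unfolding min_supp_def by blast
qed

end
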